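(* Let $\mathcal{A}$ be a commutative unital continuous inverse algebra over $\mathbf{k}\in\{\mathbb{R},\mathbb{C}\}$. Then, for every continuous polynomial map $\varphi\colon \mathcal{A}\to\mathbb{C}$ of degree $N$ which is multiplicative, i.e. $\varphi(ab)=\varphi(a)\varphi(b)$ for all $a,b\in\mathcal{A}$, there exist finitely many continuous algebra homomorphisms $\chi_1,\ldots,\chi_N\colon\mathcal{A}\to\mathbb{C}$ such that $\varphi=\chi_1\cdots\chi_N$ (pointwise product).
   Context: A unital continuous inverse algebra over $\mathbf{k}\in\{\mathbb{R},\mathbb{C}\}$ is a unital associative locally convex $\mathbf{k}$-algebra with continuous multiplication whose unit group $\mathcal{A}^\times$ is open and whose inversion $\mathcal{A}^\times\to\mathcal{A}$, $a\mapsto a^{-1}$, is continuous. A polynomial map of degree $N$ is a finite sum of homogeneous polynomials (diagonal restrictions of $\mathbf{k}$-multilinear maps) of degrees at most $N$ whose degree-$N$ component is non-zero. Algebra homomorphisms are $\mathbf{k}$-linear and multiplicative. An empty product ($N=0$) is the constant function $1$. *)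

theory Defs
  imports "HOL-Analysis.Analysis"
begin

(* The sort {ring, monoid_mult} is used in place of ring_1, because ring_1 demands
   0 ~= 1 and so leaves out the zero algebra. The topology is not required to be Hausdorff. The
   scalar multiplication is an explicit argument, so that both 'k = real and 'k = complex are
   available; of_real embeds the reals into 'k. *)
locale continuous_inverse_algebra = vector_space scale
  for scale :: "'k::real_normed_field \<Rightarrow>
    'a::{ring, monoid_mult, topological_ab_group_add, topological_semigroup_mult} \<Rightarrow> 'a" +
  assumes scale_mult_left: "scale c (a * b) = scale c a * b"
    and scale_mult_right: "scale c (a * b) = a * scale c b"
    and continuous_scale: "continuous_on UNIV (\<lambda>(c, a). scale c a)"
    and locally_convex: "\<lbrakk>open U; 0 \<in> U\<rbrakk> \<Longrightarrow>
      \<exists>V \<subseteq> U. 0 \<in> interior V \<and>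
        (\<forall>x\<in>V. \<forall>y\<in>V. \<forall>t\<in>{0..1}. scale (of_real (1 - t)) x + scale (of_real t) y \<in> V)"
    and open_units: "open {a::'a. \<exists>b. a * b = 1 \<and> b * a = 1}"
    and continuous_inverse:
      "continuous_on {a::'a. \<exists>b. a * b = 1 \<and> b * a = 1} (\<lambda>a. THE b. a * b = 1 \<and> b * a = 1)"

(* A d-linear map takes its d arguments as a list of length d; its values on lists of any other
   length are irrelevant. *)
definition multilinear ::
  "('k::field \<Rightarrow> 'a::ab_group_add \<Rightarrow> 'a) \<Rightarrow> ('k \<Rightarrow> 'b::ab_group_add \<Rightarrow> 'b) \<Rightarrow>
    nat \<Rightarrow> ('a list \<Rightarrow> 'b) \<Rightarrow> bool"
  where "multilinear s1 s2 d m \<longleftrightarrow>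
    (\<forall>xs i. length xs = d \<longrightarrow> i < d \<longrightarrow> Vector_Spaces.linear s1 s2 (\<lambda>x. m (xs[i := x])))"

definition homogeneous_polynomial ::
  "('k::field \<Rightarrow> 'a::ab_group_add \<Rightarrow> 'a) \<Rightarrow> ('k \<Rightarrow> 'b::ab_group_add \<Rightarrow> 'b) \<Rightarrow>
    nat \<Rightarrow> ('a \<Rightarrow> 'b) \<Rightarrow> bool"
  where "homogeneous_polynomial s1 s2 d p \<longleftrightarrow>
    (\<exists>m. multilinear s1 s2 d m \<and> (\<forall>x. p x = m (replicate d x)))"

definition polynomial_map_of_degree ::
  "('k::field \<Rightarrow> 'a::ab_group_add \<Rightarrow> 'a) \<Rightarrow> ('k \<Rightarrow> 'b::ab_group_add \<Rightarrow> 'b) \<Rightarrow>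
    nat \<Rightarrow> ('a \<Rightarrow> 'b) \<Rightarrow> bool"
  where "polynomial_map_of_degree s1 s2 N f \<longleftrightarrow>
    (\<exists>p. (\<forall>d\<le>N. homogeneous_polynomial s1 s2 d (p d)) \<and> (\<exists>x. p N x \<noteq> 0) \<and>
      (\<forall>x. f x = (\<Sum>d\<le>N. p d x)))"

(* Not required to preserve the unit. *)
definition algebra_homomorphism ::
  "('k::field \<Rightarrow> 'a::ring \<Rightarrow> 'a) \<Rightarrow> ('k \<Rightarrow> 'b::ring \<Rightarrow> 'b) \<Rightarrow> ('a \<Rightarrow> 'b) \<Rightarrow> bool"
  where "algebra_homomorphism s1 s2 h \<longleftrightarrow>
    Vector_Spaces.linear s1 s2 h \<and> (\<forall>a b. h (a * b) = h a * h b)"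

end

theory Submission
  imports Defs "HOL-Computational_Algebra.Fundamental_Theorem_Algebra"
begin

text \<open>
  Restrict scalars to the reals. A multiplicative polynomial map \<open>\<phi>\<close> of degree \<open>N\<close> is homogeneous of
  degree \<open>N\<close> and behaves like a norm: \<open>\<phi>(t - a)\<close> is a monic polynomial of degree \<open>N\<close> in \<open>t\<close>, and
  its multiset of roots, the spectrum of \<open>a\<close>, obeys the spectral mapping theorem for real polynomials.
  The derivative \<open>T\<close> of \<open>\<phi>\<close> at \<open>1\<close> plays the part of the trace. Its kernel
  \<open>{x. \<forall>r. T (x r) = 0}\<close> is an ideal modulo which \<open>\<phi>\<close> is invariant, and by a Cayley--Hamilton argument
  it consists of the elements with spectrum \<open>{0}\<close>. If the spectrum of some element is not contained
  in a set \<open>{\<lambda>, cnj \<lambda>}\<close>, then interpolation gives a nontrivial idempotent \<open>e\<close> modulo the kernel, and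
  \<open>\<phi>(x) = \<phi>(x e + 1 - e) \<phi>(x (1 - e) + e)\<close> splits \<open>\<phi>\<close> into factors of smaller degree. Otherwise the
  quotient by the kernel is the field of real or complex numbers, and \<open>\<phi>\<close> is a product of copies of
  the quotient map and its conjugate.

  The characters are continuous since \<open>a\<^sup>2 - 2 Re(h a) a + \<bar>h a\<bar>\<^sup>2\<close> lies in the kernel of \<open>h\<close>, so it
  cannot be invertible, whereas it is for \<open>a\<close> small compared to \<open>h a\<close>. Over the complex numbers,
  comparing \<open>\<phi>(z 1) = z\<^sup>N\<close> with the product shows that no character is conjugate linear.
\<close>

section \<open>Complex polynomials and real algebras\<close>

text \<open>Forms are evaluated along real lines only, so polynomial identities below are tested at
  real points. An arbitrary infinite \<open>S\<close> leaves room to exclude 0 or to restrict the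
  sign of the parameter.\<close>

lemma complex_poly_eqI:
  fixes p q :: "complex poly" and S :: "real set"
  assumes "infinite S" and "\<And>s. s \<in> S \<Longrightarrow> poly p (of_real s) = poly q (of_real s)"
  shows "p = q"
proof (rule ccontr)
  assume "p \<noteq> q"
  then have "finite {z. poly (p - q) z = 0}"
    by (intro poly_roots_finite) simp
  moreover have "complex_of_real ` S \<subseteq> {z. poly (p - q) z = 0}"
    using assms(2) by auto
  ultimately have "finite (complex_of_real ` S)"
    using finite_subset by blast
  then show False
    using assms(1) finite_imageD[of complex_of_real S] by (auto simp: inj_on_def)
qed

lemma infinite_nonzero_reals: "infinite {s::real. s \<noteq> 0}"
proof -
  have "infinite {0<..<1::real}" by (simp add: infinite_Ioo)
  then show ?thesis by (rule infinite_super[rotated]) auto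
qed

text \<open>Lagrange interpolation at $0, \dots, n$.\<close>
lemma coeff_by_values:
  "\<exists>w :: nat \<Rightarrow> complex. \<forall>p. degree p \<le> n \<longrightarrow> coeff p i = (\<Sum>k\<le>n. w k * poly p (of_nat k))"
proof -
  define b :: "nat \<Rightarrow> complex poly" where
    "b k = (\<Prod>j\<in>{..n} - {k}. smult (1 / (of_nat k - of_nat j)) [:- of_nat j, 1:])" for k
  have b: "poly (b k) (of_nat j) = (if j = k then 1 else 0)" if "j \<le> n" "k \<le> n" for j k
  proof (cases "j = k")
    case True
    have "poly (smult (1 / (of_nat k - of_nat j)) [:- of_nat j, 1:]) (of_nat k) = (1::complex)"
      if "j \<in> {..n} - {k}" for j
    proof -
      have "(of_nat k :: complex) - of_nat j \<noteq> 0" using that by auto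
      then show ?thesis by (simp flip: diff_divide_distrib)
    qed
    then have "poly (b k) (of_nat k) = 1" unfolding b_def poly_prod by (intro prod.neutral) blast
    then show ?thesis using True by simp
  next
    case False
    then have "j \<in> {..n} - {k}" using that by auto
    then show ?thesis using False by (auto simp: b_def poly_prod intro!: prod_zero)
  qed
  have deg: "degree (b k) \<le> n" if "k \<le> n" for k
  proof -
    have "degree (b k) \<le> (\<Sum>j\<in>{..n} - {k}. degree (smult (1 / (of_nat k - of_nat j)) [:- of_nat j, 1::complex:]))"
      unfolding b_def using degree_prod_sum_le[OF finite_Diff[OF finite_atMost]] by (simp only: o_def)
    also have "\<dots> \<le> (\<Sum>j\<in>{..n} - {k}. 1)" by (rule sum_mono) simp
    also have "\<dots> = n" using that by simp
    finally show ?thesis .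
  qed
  show ?thesis
  proof (intro exI[of _ "\<lambda>k. coeff (b k) i"] allI impI)
    fix p :: "complex poly"
    assume p: "degree p \<le> n"
    let ?q = "\<Sum>k\<le>n. smult (poly p (of_nat k)) (b k)"
    have "p = ?q"
    proof (rule poly_eqI_degree)
      fix x :: complex
      assume "x \<in> of_nat ` {..n}"
      then obtain j where j: "j \<le> n" "x = of_nat j" by auto
      have "poly ?q x = (\<Sum>k\<le>n. if k = j then poly p (of_nat k) else 0)"
        unfolding poly_sum poly_smult j(2) using b[OF j(1)] by (intro sum.cong) auto
      then show "poly p x = poly ?q x" using j by simp
    next
      have card: "card (of_nat ` {..n} :: complex set) = Suc n"
        by (subst card_image) (auto simp: inj_on_def)
      then show "card (of_nat ` {..n} :: complex set) > degree p" using p by simp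
      have "degree ?q \<le> n"
        by (intro degree_sum_le) (use deg in \<open>auto intro: order_trans[OF degree_smult_le]\<close>)
      then show "card (of_nat ` {..n} :: complex set) > degree ?q" using card by simp
    qed
    then have "coeff p i = coeff ?q i" by simp
    then show "coeff p i = (\<Sum>k\<le>n. coeff (b k) i * poly p (of_nat k))"
      by (simp add: coeff_sum mult.commute)
  qed
qed

locale commutative_real_algebra = vector_space scale
  for scale :: "real \<Rightarrow> 'a::{comm_ring, comm_monoid_mult} \<Rightarrow> 'a" (infixr "\<cdot>" 75) +
  assumes scale_mult_left: "c \<cdot> (a * b) = (c \<cdot> a) * b"
begin

lemma scale_mult_right: "c \<cdot> (a * b) = a * (c \<cdot> b)"
  using scale_mult_left[of c b a] by (simp add: mult.commute)

lemma scale_one_mult: "(c \<cdot> 1) * a = c \<cdot> a"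
  by (simp flip: scale_mult_left)

definition ev :: "real poly \<Rightarrow> 'a \<Rightarrow> 'a"
  where "ev q a = fold_coeffs (\<lambda>c x. c \<cdot> 1 + a * x) q 0"

lemma ev_0 [simp]: "ev 0 a = 0"
  by (simp add: ev_def)

lemma ev_pCons [simp]: "ev (pCons c q) a = c \<cdot> 1 + a * ev q a"
  by (cases "c = 0 \<and> q = 0") (auto simp: ev_def)

lemma ev_1 [simp]: "ev 1 a = 1"
  by (simp add: one_pCons)

lemma ev_add: "ev (p + q) a = ev p a + ev q a"
  by (induction p q rule: poly_induct2) (simp_all add: algebra_simps)

lemma ev_smult: "ev (smult c q) a = c \<cdot> ev q a"
  by (induction q) (simp_all add: scale_right_distrib scale_mult_right)

lemma ev_mult: "ev (p * q) a = ev p a * ev q a"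
  by (induction p) (simp_all add: ev_add ev_smult scale_one_mult algebra_simps)

lemma ev_diff: "ev (p - q) a = ev p a - ev q a"
  using ev_add[of "p - q" q a] by (simp add: algebra_simps)

text \<open>No degree bound on the polynomials is required: homogeneity forces it (\<open>degree_line\<close> below).\<close>

definition form :: "nat \<Rightarrow> ('a \<Rightarrow> complex) \<Rightarrow> bool"
  where "form n f \<longleftrightarrow> (\<forall>t a. t \<noteq> 0 \<longrightarrow> f (t \<cdot> a) = of_real t ^ n * f a) \<and>
    (\<forall>a b. \<exists>p. \<forall>s. f (a + s \<cdot> b) = poly p (of_real s))"

text \<open>For a form the chosen polynomial is unique, because its values at all reals are
  prescribed; see \<open>line_eqI\<close>.\<close>

definition line :: "('a \<Rightarrow> complex) \<Rightarrow> 'a \<Rightarrow> 'a \<Rightarrow> complex poly"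
  where "line f a b = (SOME p. \<forall>s. f (a + s \<cdot> b) = poly p (of_real s))"

lemma poly_line:
  assumes "form n f"
  shows "poly (line f a b) (of_real s) = f (a + s \<cdot> b)"
proof -
  have "\<exists>p. \<forall>s. f (a + s \<cdot> b) = poly p (of_real s)"
    using assms by (simp add: form_def)
  from someI_ex[OF this] show ?thesis
    unfolding line_def by metis
qed

lemma form_scale: "form n f \<Longrightarrow> t \<noteq> 0 \<Longrightarrow> f (t \<cdot> a) = of_real t ^ n * f a"
  by (simp add: form_def)

lemma line_eqI:
  assumes "form n f" "infinite S" "\<And>s. s \<in> S \<Longrightarrow> f (a + s \<cdot> b) = poly p (of_real s)"
  shows "line f a b = p"
  using assms by (intro complex_poly_eqI[of S]) (auto simp: poly_line[OF assms(1)])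

text \<open>For \<open>s \<noteq> 0\<close> homogeneity gives
  \<open>f (a + s \<cdot> b) = s ^ n * f (b + inverse s \<cdot> a)\<close>, so the two restrictions
  are reversals of each other in degree \<open>n\<close>. The factor
  \<open>monom 1 (degree q)\<close> appears because \<open>reflect_poly\<close> reverses at the
  actual degree of \<open>q\<close>, which may differ from \<open>n\<close>.\<close>

lemma line_reverse:
  assumes "form n f"
  shows "coeff (line f a b) k = (if k \<le> n then coeff (line f b a) (n - k) else 0)"
proof -
  define p q where "p = line f a b" and "q = line f b a"
  have "monom 1 (degree q) * p = monom 1 n * reflect_poly q"
  proof (rule complex_poly_eqI[OF infinite_nonzero_reals])
    fix s :: real
    assume "s \<in> {s. s \<noteq> 0}"
    then have s: "s \<noteq> 0" by simp
    have "f (a + s \<cdot> b) = f (s \<cdot> (b + inverse s \<cdot> a))"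
      using s by (simp add: scale_right_distrib add.commute)
    also have "\<dots> = of_real s ^ n * poly q (inverse (of_real s))"
      using form_scale[OF assms s] poly_line[OF assms, of b a "inverse s"]
      by (simp add: q_def of_real_inverse)
    finally show "poly (monom 1 (degree q) * p) (of_real s) =
        poly (monom 1 n * reflect_poly q) (of_real s)"
      using s by (simp add: poly_monom poly_reflect_poly_nz p_def poly_line[OF assms] of_real_inverse)
  qed
  then have "coeff (monom 1 (degree q) * p) (degree q + k) =
      coeff (monom 1 n * reflect_poly q) (degree q + k)"
    by simp
  then show ?thesis
    unfolding p_def[symmetric] q_def[symmetric]
    by (auto simp: coeff_monom_mult coeff_reflect_poly coeff_eq_0 split: if_splits)
qed

lemma degree_line: "form n f \<Longrightarrow> degree (line f a b) \<le> n"
  by (rule degree_le) (simp add: line_reverse)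

lemma coeff_line_0: "form n f \<Longrightarrow> coeff (line f a b) 0 = f a"
  using poly_line[of n f a b 0] by (simp add: poly_0_coeff_0)

lemma coeff_line_top: "form n f \<Longrightarrow> coeff (line f a b) n = f b"
  using line_reverse[of n f a b n] by (simp add: coeff_line_0)

text \<open>The case \<open>t = 0\<close> is forced by polynomiality along the line through 0 and
  \<open>a\<close>. For \<open>n = 0\<close> it says that \<open>f\<close> is constant, as
  \<open>0 ^ 0 = 1\<close>.\<close>

lemma form_scale_any:
  assumes "form n f"
  shows "f (t \<cdot> a) = of_real t ^ n * f a"
proof -
  have "line f 0 a = monom (f a) n"
    by (rule line_eqI[OF assms infinite_nonzero_reals])
      (simp add: form_scale[OF assms] poly_monom mult.commute)
  then show ?thesis
    using poly_line[OF assms, of 0 a t] by (simp add: poly_monom mult.commute)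
qed

end

text \<open>\<open>cev\<close> evaluates real polynomials at spectral values, under the same rules
  as \<open>ev\<close> in the algebra.\<close>

global_interpretation complex_algebra: commutative_real_algebra "scaleR :: real \<Rightarrow> complex \<Rightarrow> complex"
  defines cev = complex_algebra.ev
  by unfold_locales (simp_all add: algebra_simps)

lemma ev_complex: "cev q z = poly (map_poly of_real q) z"
  by (induction q) (simp_all add: map_poly_pCons scaleR_conv_of_real)

lemma ev_complex_cnj: "cev q (cnj z) = cnj (cev q z)"
  by (induction q) (simp_all add: complex_algebra.ev_pCons)

text \<open>The polynomial (X - z)(X - cnj z); for real \<open>z\<close> it is a square.\<close>

definition norm_poly :: "complex \<Rightarrow> real poly"
  where "norm_poly z = [:(Re z)\<^sup>2 + (Im z)\<^sup>2, - 2 * Re z, 1:]"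

lemma ev_norm_poly: "cev (norm_poly z) x = (x - z) * (x - cnj z)"
  by (simp add: norm_poly_def complex_eq_iff algebra_simps power2_eq_square)

text \<open>A complex root \<open>z\<close> exists. If it is not real, the remainder modulo
  \<open>norm_poly z\<close> is a real polynomial of degree at most 1 that vanishes at
  \<open>z\<close>, hence it is zero.\<close>

lemma real_poly_linear_or_quadratic_factor:
  fixes q :: "real poly"
  assumes "degree q > 0"
  obtains c r where "q = [:- c, 1:] * r" | z r where "q = norm_poly z * r"
proof -
  have "\<not> constant (poly (map_poly complex_of_real q))"
    using assms by (simp add: constant_degree degree_map_poly)
  then obtain z where z: "cev q z = 0"
    unfolding ev_complex using fundamental_theorem_of_algebra by blast
  show thesis
  proof (cases "Im z = 0")
    case True
    then have "z = of_real (Re z)" by (simp add: complex_eq_iff)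
    moreover have "cev q (of_real x) = of_real (poly q x)" for x
      by (induction q) (simp_all add: scaleR_conv_of_real)
    ultimately have "poly q (Re z) = 0"
      using z by (metis of_real_eq_0_iff)
    then show thesis using that(1) by (auto simp: poly_eq_0_iff_dvd elim: dvdE)
  next
    case False
    define r where "r = q mod norm_poly z"
    have "norm_poly z \<noteq> 0" "degree (norm_poly z) = 2" by (simp_all add: norm_poly_def)
    then have deg: "degree r \<le> 1"
      using degree_mod_less[of "norm_poly z" q] by (auto simp: r_def)
    have q: "q = norm_poly z * (q div norm_poly z) + r" by (simp add: r_def)
    have "cev r z = 0"
      using z by (subst (asm) q) (simp add: complex_algebra.ev_add complex_algebra.ev_mult ev_norm_poly)
    moreover obtain \<alpha> \<beta> where r: "r = [:\<alpha>, \<beta>:]"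
      using degree1_coeffs deg by (metis One_nat_def degree_eq_zeroE le_Suc_eq le_zero_eq pCons_0_0 degree_0 pCons_eq_iff)
    ultimately have "r = 0" using False by (auto simp: complex_eq_iff)
    then show thesis using that(2) q by simp
  qed
qed

section \<open>Spectrum, trace and kernel of a multiplicative form\<close>

lemma proots_prod_linear: "proots (\<Prod>z\<in>#M. [:- z, 1:]) = (M :: complex multiset)"
proof (induction M)
  case (add x M)
  have "(\<Prod>z\<in>#M. [:- z, 1:]) \<noteq> (0 :: complex poly)" by auto
  then show ?case
    by (simp add: proots_mult add del: mult_pCons_left)
qed simp

locale multiplicative_form = commutative_real_algebra scale
  for scale :: "real \<Rightarrow> 'a::{comm_ring, comm_monoid_mult} \<Rightarrow> 'a" (infixr "\<cdot>" 75) +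
  fixes \<phi> :: "'a \<Rightarrow> complex" and N :: nat
  assumes phi_mult: "\<phi> (a * b) = \<phi> a * \<phi> b"
    and phi_one: "\<phi> 1 = 1"
    and phi_form: "form N \<phi>"
begin

lemmas poly_phi = poly_line[OF phi_form]

lemma phi_scalar: "\<phi> (c \<cdot> 1) = of_real c ^ N"
  using form_scale_any[OF phi_form, of c 1] by (simp add: phi_one)

text \<open>If \<open>\<phi>\<close> is a determinant, this is the usual characteristic
  polynomial.\<close>

definition char_poly :: "'a \<Rightarrow> complex poly"
  where "char_poly a = line \<phi> (- a) 1"

definition spec :: "'a \<Rightarrow> complex multiset"
  where "spec a = proots (char_poly a)"

lemma poly_char_poly: "poly (char_poly a) (of_real t) = \<phi> (t \<cdot> 1 - a)"
  by (simp add: char_poly_def poly_phi)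

text \<open>The coefficient at \<open>N\<close> is \<open>\<phi> 1 = 1\<close>, so the polynomial is
  monic of degree exactly \<open>N\<close> and splits over the complex numbers.\<close>

lemma char_poly_eq: "char_poly a = (\<Prod>z\<in>#spec a. [:- z, 1:])"
  and size_spec: "size (spec a) = N"
proof -
  have lead: "coeff (char_poly a) N = 1"
    by (simp add: char_poly_def coeff_line_top[OF phi_form] phi_one)
  then have "char_poly a \<noteq> 0" by auto
  moreover have deg: "degree (char_poly a) = N"
    using degree_line[OF phi_form, of "- a" 1] lead
    by (intro antisym le_degree) (auto simp: char_poly_def)
  ultimately obtain M where M: "size M = N" "char_poly a = (\<Prod>z\<in>#M. [:- z, 1:])"
    using alg_closed_imp_factorization[of "char_poly a"] lead by auto
  moreover have "spec a = M" by (simp add: spec_def M(2) proots_prod_linear)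
  ultimately show "char_poly a = (\<Prod>z\<in>#spec a. [:- z, 1:])" "size (spec a) = N"
    by simp_all
qed

lemma phi_scalar_minus: "\<phi> (t \<cdot> 1 - a) = (\<Prod>z\<in>#spec a. of_real t - z)"
  using poly_char_poly[of a t] by (simp add: char_poly_eq poly_prod_mset image_mset.compositionality o_def)

lemma spec_eqI:
  assumes "infinite S" "\<And>t. t \<in> S \<Longrightarrow> \<phi> (t \<cdot> 1 - a) = (\<Prod>z\<in>#M. of_real t - z)"
  shows "spec a = M"
proof -
  have "char_poly a = (\<Prod>z\<in>#M. [:- z, 1:])"
    by (rule complex_poly_eqI[OF assms(1)])
      (simp add: poly_char_poly assms(2) poly_prod_mset image_mset.compositionality o_def)
  then show ?thesis by (simp add: spec_def proots_prod_linear)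
qed

text \<open>Both sides are multiplicative in \<open>q\<close>, so constants, linear factors and the
  polynomials \<open>norm_poly w\<close> suffice.\<close>

lemma phi_ev: "\<phi> (ev q a) = (\<Prod>z\<in>#spec a. cev q z)"
proof -
  define ok where "ok q \<longleftrightarrow> \<phi> (ev q a) = (\<Prod>z\<in>#spec a. cev q z)" for q
  have mult: "ok (p * q)" if "ok p" "ok q" for p q
    using that by (simp add: ok_def ev_mult phi_mult complex_algebra.ev_mult prod_mset.distrib)
  have const: "ok [:c:]" for c
    by (simp add: ok_def phi_scalar size_spec scaleR_conv_of_real)
  have "ok [:c, - 1:]" for c
    using phi_scalar_minus[of c a] by (simp add: ok_def scaleR_conv_of_real)
  from mult[OF this const[of "- 1"]] have linear: "ok [:- c, 1:]" for c
    by simp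
  have quadratic: "ok (norm_poly w)" for w
  proof -
    define d where "d = [:- Re w, 1:]\<^sup>2"
    \<comment> \<open>For \<open>s \<le> 0\<close> the polynomial \<open>d + [:s:]\<close> splits
      into real linear factors. The resulting identity is polynomial in \<open>s\<close>, so it
      persists at \<open>s = (Im w)^2\<close>.\<close>
    have "line \<phi> (ev d a) 1 = (\<Prod>z\<in>#spec a. [:cev d z, 1:])"
    proof (rule line_eqI[OF phi_form])
      show "infinite {s::real. s \<le> 0}"
        using infinite_Iic by (simp add: atMost_def)
      fix s :: real
      assume "s \<in> {s. s \<le> 0}"
      then have "d + [:s:] = [:- (Re w + sqrt (- s)), 1:] * [:- (Re w - sqrt (- s)), 1:]"
        by (simp add: d_def power2_eq_square algebra_simps)
      then have "ok (d + [:s:])" using mult[OF linear linear] by metis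
      then show "\<phi> (ev d a + s \<cdot> 1) = poly (\<Prod>z\<in>#spec a. [:cev d z, 1:]) (of_real s)"
        by (simp add: ok_def ev_add complex_algebra.ev_add poly_prod_mset
            image_mset.compositionality o_def scaleR_conv_of_real add.commute)
    qed
    from poly_phi[of "ev d a" 1 "(Im w)\<^sup>2", unfolded this]
    have "ok (d + [:(Im w)\<^sup>2:])"
      by (simp add: ok_def ev_add complex_algebra.ev_add poly_prod_mset
            image_mset.compositionality o_def scaleR_conv_of_real add.commute)
    also have "d + [:(Im w)\<^sup>2:] = norm_poly w"
      by (simp add: d_def norm_poly_def power2_eq_square)
    finally show ?thesis .
  qed
  have "ok q"
  proof (induction "degree q" arbitrary: q rule: less_induct)
    case less
    show ?case
    proof (cases "degree q = 0")
      case True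
      then show ?thesis using const by (metis degree_eq_zeroE)
    next
      case False
      then have "degree q > 0" by simp
      then show ?thesis
      proof (cases rule: real_poly_linear_or_quadratic_factor)
        case (1 c r)
        with False have "r \<noteq> 0" by auto
        then have "degree r < degree q" unfolding 1 by (subst degree_mult_eq) auto
        from less[OF this] show ?thesis unfolding 1 by (intro mult linear)
      next
        case (2 z r)
        with False have "r \<noteq> 0" by auto
        then have "degree r < degree q"
          unfolding 2 by (subst degree_mult_eq) (auto simp: norm_poly_def)
        from less[OF this] show ?thesis unfolding 2 by (intro mult quadratic)
      qed
    qed
  qed
  then show ?thesis by (simp add: ok_def)
qed

lemma spec_ev: "spec (ev q a) = image_mset (cev q) (spec a)"
proof (rule spec_eqI)
  show "infinite (UNIV :: real set)" by (rule infinite_UNIV_char_0)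
  fix t :: real
  show "\<phi> (t \<cdot> 1 - ev q a) = (\<Prod>z\<in>#image_mset (cev q) (spec a). of_real t - z)"
    using phi_ev[of "[:t:] - q" a]
    by (simp add: ev_diff complex_algebra.ev_diff image_mset.compositionality o_def scaleR_conv_of_real)
qed

section \<open>Derivative of the form and the trace\<close>

definition D :: "'a \<Rightarrow> 'a \<Rightarrow> complex"
  where "D a r = coeff (line \<phi> a r) 1"

definition T :: "'a \<Rightarrow> complex"
  where "T r = D 1 r"

text \<open>\<open>\<phi>\<close> is given as a polynomial on lines only. Interpolation makes every
  coefficient in direction \<open>d\<close> polynomial along \<open>c\<close>; restricting to the
  diagonal and comparing linear terms gives additivity.\<close>

lemma D_add: "D a (c + d) = D a c + D a d"
proof -
  have "\<exists>Q. \<forall>s. coeff (line \<phi> (a + s \<cdot> c) d) k = poly Q (of_real s)" for k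
  proof -
    obtain w :: "nat \<Rightarrow> complex" where "\<And>p. degree p \<le> N \<Longrightarrow> coeff p k = (\<Sum>j\<le>N. w j * poly p (of_nat j))"
      using coeff_by_values[of N k] by blast
    then have w: "coeff (line \<phi> x d) k = (\<Sum>j\<le>N. w j * \<phi> (x + of_nat j \<cdot> d))" for x
      using degree_line[OF phi_form] poly_phi[of x d "of_nat _"] by simp
    have "coeff (line \<phi> (a + s \<cdot> c) d) k =
        poly (\<Sum>j\<le>N. smult (w j) (line \<phi> (a + of_nat j \<cdot> d) c)) (of_real s)" for s
      by (simp add: w poly_sum poly_phi algebra_simps)
    then show ?thesis by blast
  qed
  then obtain Q where Q: "\<And>k s. coeff (line \<phi> (a + s \<cdot> c) d) k = poly (Q k) (of_real s)"
    by metis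
  \<comment> \<open>The bound \<open>Suc N\<close> instead of \<open>N\<close> keeps the index 1 in
    range when \<open>N = 0\<close>.\<close>
  have "line \<phi> a (c + d) = (\<Sum>k\<le>Suc N. monom 1 k * Q k)"
  proof (rule line_eqI[OF phi_form infinite_UNIV_char_0])
    fix s :: real
    have "\<phi> (a + s \<cdot> (c + d)) = poly (line \<phi> (a + s \<cdot> c) d) (of_real s)"
      by (simp add: poly_phi scale_right_distrib add.assoc)
    also have "\<dots> = (\<Sum>k\<le>Suc N. coeff (line \<phi> (a + s \<cdot> c) d) k * of_real s ^ k)"
      unfolding poly_altdef using degree_line[OF phi_form, of "a + s \<cdot> c" d]
      by (intro sum.mono_neutral_left) (auto simp: coeff_eq_0)
    finally show "\<phi> (a + s \<cdot> (c + d)) = poly (\<Sum>k\<le>Suc N. monom 1 k * Q k) (of_real s)"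
      by (simp add: Q poly_sum poly_monom mult.commute)
  qed
  then have "D a (c + d) = (\<Sum>k\<le>Suc N. if k \<le> 1 then coeff (Q k) (1 - k) else 0)"
    by (auto simp: D_def coeff_sum coeff_monom_mult intro!: sum.cong)
  also have "\<dots> = coeff (Q 0) 1 + coeff (Q 1) 0"
    by (subst sum.mono_neutral_right[of "{..Suc N}" "{0, 1}"]) auto
  also have "Q 0 = line \<phi> a c"
    using Q[of _ 0] by (intro line_eqI[OF phi_form infinite_UNIV_char_0, symmetric])
      (simp add: coeff_line_0[OF phi_form])
  also have "coeff (Q 1) 0 = D a d"
    using Q[of 0 1] by (simp add: D_def poly_0_coeff_0)
  finally show ?thesis by (simp add: D_def)
qed

lemma D_scale_right: "D a (c \<cdot> r) = of_real c * D a r"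
proof -
  have "line \<phi> a (c \<cdot> r) = pcompose (line \<phi> a r) [:0, of_real c:]"
    by (rule line_eqI[OF phi_form infinite_UNIV_char_0])
      (simp add: poly_pcompose poly_phi[symmetric] flip: of_real_mult)
  then show ?thesis by (simp add: D_def coeff_pcompose_linear)
qed

lemma D_diff: "D a (c - d) = D a c - D a d"
  using D_add[of a "c - d" d] by simp

text \<open>Jacobi's formula without inverting \<open>u\<close>: \<open>\<phi> (u + s \<cdot> (u *
  r)) = \<phi> u * \<phi> (1 + s \<cdot> r)\<close>.\<close>

lemma D_mult: "D u (u * r) = \<phi> u * T r"
proof -
  have "line \<phi> u (u * r) = smult (\<phi> u) (line \<phi> 1 r)"
    by (rule line_eqI[OF phi_form infinite_UNIV_char_0])
      (simp add: poly_phi distrib_left flip: phi_mult scale_mult_right)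
  then show ?thesis by (simp add: D_def T_def)
qed

lemma T_add: "T (a + b) = T a + T b" and T_diff: "T (a - b) = T a - T b"
  by (simp_all add: T_def D_add D_diff)

context
  assumes N_pos: "N > 0"
begin

text \<open>Polynomiality in the base point holds because \<open>D x r\<close> is a fixed linear
  combination of the values \<open>\<phi> (x + of_nat j \<cdot> r)\<close>.\<close>

lemma D_form: "form (N - 1) (\<lambda>a. D a r)"
  unfolding form_def
proof (intro conjI allI impI)
  fix t :: real and a
  assume t: "t \<noteq> 0"
  have "line \<phi> (t \<cdot> a) r = smult (of_real t ^ N) (pcompose (line \<phi> a r) [:0, of_real (1 / t):])"
  proof (rule line_eqI[OF phi_form infinite_UNIV_char_0])
    fix s :: real
    have "t \<cdot> a + s \<cdot> r = t \<cdot> (a + (s / t) \<cdot> r)"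
      using t by (simp add: scale_right_distrib)
    then show "\<phi> (t \<cdot> a + s \<cdot> r) = poly (smult (of_real t ^ N)
        (pcompose (line \<phi> a r) [:0, of_real (1 / t):])) (of_real s)"
      using poly_phi[of a r "s / t"] form_scale_any[OF phi_form] by (simp add: poly_pcompose)
  qed
  then show "D (t \<cdot> a) r = of_real t ^ (N - 1) * D a r"
    using t N_pos by (simp add: D_def coeff_pcompose_linear power_diff)
next
  fix a b
  obtain w :: "nat \<Rightarrow> complex"
    where "\<And>p. degree p \<le> N \<Longrightarrow> coeff p 1 = (\<Sum>j\<le>N. w j * poly p (of_nat j))"
    using coeff_by_values[of N 1] by blast
  then have w: "D x r = (\<Sum>j\<le>N. w j * \<phi> (x + of_nat j \<cdot> r))" for x
    using degree_line[OF phi_form] poly_phi[of x r "of_nat _"] by (simp add: D_def)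
  have "D (a + s \<cdot> b) r = poly (\<Sum>j\<le>N. smult (w j) (line \<phi> (a + of_nat j \<cdot> r) b)) (of_real s)" for s
    by (simp add: w poly_sum poly_phi algebra_simps)
  then show "\<exists>p. \<forall>s. D (a + s \<cdot> b) r = poly p (of_real s)" by blast
qed

text \<open>If \<open>\<phi>\<close> is a determinant, this is the trace of \<open>r\<close> times
  the adjugate of \<open>t - a\<close>, as a polynomial in \<open>t\<close>.\<close>

definition D_poly :: "'a \<Rightarrow> 'a \<Rightarrow> complex poly"
  where "D_poly a r = line (\<lambda>b. D b r) (- a) 1"

lemma poly_D_poly: "poly (D_poly a r) (of_real t) = D (t \<cdot> 1 - a) r"
  by (simp add: D_poly_def poly_line[OF D_form])

lemma degree_D_poly: "degree (D_poly a r) < N"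
  using degree_line[OF D_form, of r "- a" 1] N_pos by (simp add: D_poly_def)

lemma coeff_D_poly_top: "coeff (D_poly a r) (N - 1) = T r"
  unfolding D_poly_def T_def by (rule coeff_line_top[OF D_form])

text \<open>Cayley-Hamilton in trace form: modulo \<open>char_poly a\<close>, multiplying
  \<open>r\<close> by \<open>a\<close> multiplies the polynomial by its variable. The source is
  \<open>a * r = t \<cdot> r - (t \<cdot> 1 - a) * r\<close> together with
  \<open>D_mult\<close>.\<close>

lemma D_poly_mult: "D_poly a (a * r) = pCons 0 (D_poly a r) - smult (T r) (char_poly a)"
proof (rule complex_poly_eqI[OF infinite_UNIV_char_0])
  fix t :: real
  have "a * r = t \<cdot> r - (t \<cdot> 1 - a) * r"
    by (simp add: left_diff_distrib scale_one_mult)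
  then have "D (t \<cdot> 1 - a) (a * r) = of_real t * D (t \<cdot> 1 - a) r - \<phi> (t \<cdot> 1 - a) * T r"
    by (simp only: D_diff D_scale_right D_mult)
  then show "poly (D_poly a (a * r)) (of_real t) =
      poly (pCons 0 (D_poly a r) - smult (T r) (char_poly a)) (of_real t)"
    by (simp add: poly_D_poly poly_char_poly)
qed

end

section \<open>The radical of the trace form\<close>

definition kernel :: "'a set"
  where "kernel = {x. \<forall>r. T (x * r) = 0}"

lemma kernel_T: "x \<in> kernel \<Longrightarrow> T x = 0"
  using mult_1_right[of x] by (metis (mono_tags) kernel_def mem_Collect_eq)

lemma kernel_0: "0 \<in> kernel"
  using T_diff[of 0 0] by (simp add: kernel_def)

lemma kernel_mult: "x \<in> kernel \<Longrightarrow> x * y \<in> kernel"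
  by (simp add: kernel_def mult.assoc)

lemma kernel_mult': "x \<in> kernel \<Longrightarrow> y * x \<in> kernel"
  using kernel_mult[of x y] by (simp add: mult.commute)

lemma kernel_add: "x \<in> kernel \<Longrightarrow> y \<in> kernel \<Longrightarrow> x + y \<in> kernel"
  by (simp add: kernel_def distrib_right T_add)

lemma kernel_diff: "x \<in> kernel \<Longrightarrow> y \<in> kernel \<Longrightarrow> x - y \<in> kernel"
  by (simp add: kernel_def left_diff_distrib T_diff)

lemma kernel_minus: "x \<in> kernel \<Longrightarrow> - x \<in> kernel"
  using kernel_diff[OF kernel_0, of x] by simp

lemma kernel_scale: "x \<in> kernel \<Longrightarrow> c \<cdot> x \<in> kernel"
  using kernel_mult'[of x "c \<cdot> 1"] by (simp add: scale_one_mult)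

text \<open>All traces \<open>T ((- a) ^ k * x)\<close> vanish, so \<open>D_poly_mult\<close> has no
  correction term and \<open>(- a) ^ N * x\<close> yields \<open>monom 1 N * D_poly (- a) x\<close>.
  Its degree is below \<open>N\<close>, so \<open>D_poly (- a) x\<close> is zero; its value at 0 is
  \<open>D a x\<close>.\<close>

lemma D_kernel:
  assumes "x \<in> kernel"
  shows "D a x = 0"
proof (cases "N = 0")
  case True
  then show ?thesis
    using degree_line[OF phi_form, of a x] by (simp add: D_def coeff_eq_0)
next
  case False
  then have N: "N > 0" by simp
  have "D_poly (- a) ((- a) ^ k * x) = monom 1 k * D_poly (- a) x" for k
  proof (induction k)
    case 0
    then show ?case by (simp add: monom_0 one_pCons[symmetric])
  next
    case (Suc k)
    have "T ((- a) ^ k * x) = 0" by (intro kernel_T kernel_mult' assms)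
    then show ?case
      using D_poly_mult[OF N, of "- a" "(- a) ^ k * x"] Suc
      by (simp add: monom_Suc mult.assoc)
  qed
  from this[of N] have "monom 1 N * D_poly (- a) x = D_poly (- a) ((- a) ^ N * x)" by simp
  moreover have "degree (D_poly (- a) ((- a) ^ N * x)) < N" by (rule degree_D_poly[OF N])
  ultimately have "D_poly (- a) x = 0"
    using degree_mult_eq[of "monom 1 N" "D_poly (- a) x"] by (auto simp: degree_monom_eq)
  then show ?thesis using poly_D_poly[OF N, of "- a" x 0] by simp
qed

text \<open>By \<open>D_kernel\<close> at every base point \<open>a + s \<cdot> x\<close>, the
  polynomial \<open>\<phi> (a + s \<cdot> x)\<close> in \<open>s\<close> has derivative
  zero.\<close>

lemma phi_add_kernel:
  assumes "x \<in> kernel"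
  shows "\<phi> (a + x) = \<phi> a"
proof -
  define p where "p = line \<phi> a x"
  have "pderiv p = 0"
  proof (rule complex_poly_eqI[OF infinite_UNIV_char_0])
    fix s :: real
    have "line \<phi> (a + s \<cdot> x) x = pcompose p [:of_real s, 1:]"
    proof (rule line_eqI[OF phi_form infinite_UNIV_char_0])
      fix u :: real
      show "\<phi> (a + s \<cdot> x + u \<cdot> x) = poly (pcompose p [:of_real s, 1:]) (of_real u)"
        using poly_phi[of a x "s + u"] by (simp add: p_def poly_pcompose scale_left_distrib add.assoc)
    qed
    then have "coeff (pcompose p [:of_real s, 1:]) 1 = 0"
      using D_kernel[OF assms, of "a + s \<cdot> x"] by (simp add: D_def)
    then have "poly (pderiv (pcompose p [:of_real s, 1:])) 0 = 0"
      by (simp add: poly_0_coeff_0 coeff_pderiv)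
    then show "poly (pderiv p) (of_real s) = poly 0 (of_real s)"
      by (simp add: pderiv_pcompose poly_pcompose pderiv_pCons)
  qed
  then obtain c where "p = [:c:]"
    using pderiv_eq_0_iff degree_eq_zeroE by blast
  then show ?thesis
    using poly_phi[of a x 1] poly_phi[of a x 0] by (simp add: p_def)
qed

lemma phi_cong: "a - b \<in> kernel \<Longrightarrow> \<phi> a = \<phi> b"
  using phi_add_kernel[of "a - b" b] by simp

text \<open>Reversal turns this coefficient into the linear one of
  \<open>\<phi> (1 - s \<cdot> a)\<close>. By Vieta, \<open>T a\<close> is thus the sum of the
  spectrum.\<close>

lemma T_eq_coeff:
  assumes "N > 0"
  shows "coeff (char_poly a) (N - 1) = - T a"
proof -
  have "coeff (char_poly a) (N - 1) = D 1 (- a)"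
    using assms line_reverse[OF phi_form, of "- a" 1 "N - 1"]
    by (simp add: char_poly_def D_def)
  then show ?thesis
    using D_diff[of 1 0 a] D_diff[of 1 0 0] by (simp add: T_def)
qed

text \<open>First \<open>n ^ N\<close> is shown to lie in the kernel. For \<open>x = n * r\<close>
  the power \<open>x ^ N\<close> then lies there too and has spectrum zero; by spectral mapping so
  has \<open>x\<close>, whence \<open>T x = 0\<close>.\<close>

lemma kernel_if_spec_zero:
  assumes "set_mset (spec n) \<subseteq> {0}"
  shows "n \<in> kernel"
proof (cases "N = 0")
  case True
  then show ?thesis
    using degree_line[OF phi_form] by (simp add: kernel_def T_def D_def coeff_eq_0)
next
  case False
  then have N: "N > 0" by simp
  have zero_spec: "char_poly a = monom 1 N" if "set_mset (spec a) \<subseteq> {0}" for a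
  proof -
    have "spec a = replicate_mset N 0"
      using that size_spec[of a] by (metis set_mset_subset_singletonD)
    then show ?thesis
      by (simp add: char_poly_eq monom_altdef)
  qed
  have power: "n ^ N \<in> kernel"
    unfolding kernel_def
  proof (intro CollectI allI)
    fix r
    \<comment> \<open>Since \<open>char_poly n = monom 1 N\<close>, the corrections in
      \<open>D_poly_mult\<close> are multiples of \<open>monom 1 N\<close>. At \<open>k = N\<close>
      this makes a polynomial of degree below \<open>N\<close> divisible by
      \<open>monom 1 N\<close>.\<close>
    have "monom 1 N dvd D_poly n (n ^ k * r) - monom 1 k * D_poly n r" for k
    proof (induction k)
      case 0
      then show ?case by (simp add: monom_0 one_pCons[symmetric])
    next
      case (Suc k)
      have "D_poly n (n ^ Suc k * r) - monom 1 (Suc k) * D_poly n r =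
          [:0, 1:] * (D_poly n (n ^ k * r) - monom 1 k * D_poly n r) -
          [:T (n ^ k * r):] * monom 1 N"
        using D_poly_mult[OF N, of n "n ^ k * r"]
        by (simp add: zero_spec[OF assms] monom_Suc mult.assoc algebra_simps)
      also have "monom 1 N dvd \<dots>"
        by (intro dvd_diff dvd_mult Suc dvd_refl)
      finally show ?case .
    qed
    from this[of N] have "monom 1 N dvd D_poly n (n ^ N * r)"
      by (metis dvd_triv_left dvd_diff_left_iff)
    then have "D_poly n (n ^ N * r) = 0"
      using degree_D_poly[OF N, of n "n ^ N * r"] divides_degree[of "monom 1 N"]
      by (fastforce simp: degree_monom_eq)
    then show "T (n ^ N * r) = 0"
      using coeff_D_poly_top[OF N, of n] by (metis coeff_0)
  qed
  show ?thesis
    unfolding kernel_def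
  proof (intro CollectI allI)
    fix r
    define x where "x = n * r"
    have x: "x ^ N \<in> kernel"
      unfolding x_def power_mult_distrib by (rule kernel_mult[OF power])
    have ev: "ev (monom 1 N) x = x ^ N"
      by (induction N) (simp_all add: monom_0 monom_Suc)
    have cev: "cev (monom 1 N) = (\<lambda>z. z ^ N)"
      by (induction N) (simp_all add: monom_0 monom_Suc fun_eq_iff)
    have "spec (x ^ N) = replicate_mset N 0"
    proof (rule spec_eqI[OF infinite_UNIV_char_0])
      fix t :: real
      have "\<phi> (t \<cdot> 1 - x ^ N) = \<phi> (t \<cdot> 1)"
        using x by (intro phi_cong) (simp add: kernel_minus)
      then show "\<phi> (t \<cdot> 1 - x ^ N) = (\<Prod>z\<in>#replicate_mset N 0. of_real t - z)"
        by (simp add: phi_scalar)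
    qed
    then have "image_mset (\<lambda>z. z ^ N) (spec x) = replicate_mset N 0"
      using spec_ev[of "monom 1 N" x] by (simp add: ev cev)
    then have "(\<lambda>z. z ^ N) ` set_mset (spec x) \<subseteq> {0}"
      by (metis set_image_mset set_mset_replicate_mset_subset subset_refl empty_subsetI)
    then have "set_mset (spec x) \<subseteq> {0}" by auto
    from zero_spec[OF this] have "T x = 0"
      using T_eq_coeff[OF N, of x] N by (simp split: if_splits)
    then show "T (n * r) = 0" by (simp add: x_def)
  qed
qed

lemma spec_kernel:
  assumes "x \<in> kernel"
  shows "spec x = replicate_mset N 0"
proof (rule spec_eqI[OF infinite_UNIV_char_0])
  fix t :: real
  have "\<phi> (t \<cdot> 1 - x) = \<phi> (t \<cdot> 1)"
    using assms by (intro phi_cong) (simp add: kernel_minus)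
  then show "\<phi> (t \<cdot> 1 - x) = (\<Prod>z\<in>#replicate_mset N 0. of_real t - z)"
    by (simp add: phi_scalar)
qed

end

section \<open>Factorization into characters\<close>

text \<open>A product of polynomials \<open>norm_poly x\<close> kills the points outside the
  conjugate pair; a real factor of degree at most 1 then normalises the value at
  \<open>\<nu>\<close>. Real coefficients carry the value 1 over to
  \<open>cnj \<nu>\<close>.\<close>

lemma separating_real_poly:
  assumes "finite S"
  obtains q where "cev q \<nu> = 1" "\<And>z. z \<in> S \<Longrightarrow> cev q z = (if z = \<nu> \<or> z = cnj \<nu> then 1 else 0)"
proof -
  have "\<exists>w. cev w \<nu> \<noteq> 0 \<and> (\<forall>z\<in>S. z \<noteq> \<nu> \<and> z \<noteq> cnj \<nu> \<longrightarrow> cev w z = 0)"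
    using assms
  proof (induction S)
    case empty
    show ?case by (rule exI[of _ 1]) simp
  next
    case (insert x S)
    then obtain w where w: "cev w \<nu> \<noteq> 0" "\<forall>z\<in>S. z \<noteq> \<nu> \<and> z \<noteq> cnj \<nu> \<longrightarrow> cev w z = 0"
      by blast
    show ?case
    proof (cases "x = \<nu> \<or> x = cnj \<nu>")
      case True
      then show ?thesis using w by (intro exI[of _ w]) auto
    next
      case False
      then have "\<nu> \<noteq> x" "\<nu> \<noteq> cnj x" by auto
      then show ?thesis using w
        by (intro exI[of _ "norm_poly x * w"]) (auto simp: complex_algebra.ev_mult ev_norm_poly)
    qed
  qed
  then obtain w where w: "cev w \<nu> \<noteq> 0" "\<And>z. z \<in> S \<Longrightarrow> z \<noteq> \<nu> \<Longrightarrow> z \<noteq> cnj \<nu> \<Longrightarrow> cev w z = 0"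
    by blast
  define d where "d = 1 / cev w \<nu>"
  have "\<exists>v. cev v \<nu> = d"
  \<comment> \<open>For real \<open>\<nu>\<close> only real values can be attained, and
    \<open>d\<close> is real. Otherwise 1 and \<open>\<nu>\<close> form a real basis of the complex
    numbers.\<close>
  proof (cases "Im \<nu> = 0")
    case True
    then have "cnj \<nu> = \<nu>" by (simp add: complex_eq_iff)
    then have "cnj d = d" using ev_complex_cnj[of w \<nu>] by (simp add: d_def)
    then have "Im d = 0" by (simp add: complex_eq_iff)
    then show ?thesis by (intro exI[of _ "[:Re d:]"]) (simp add: complex_eq_iff)
  next
    case False
    then show ?thesis
      by (intro exI[of _ "[:Re d - Im d * Re \<nu> / Im \<nu>, Im d / Im \<nu>:]"]) (simp add: complex_eq_iff)
  qed
  then obtain v where "cev v \<nu> = d" by blast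
  then have 1: "cev (v * w) \<nu> = 1"
    using w(1) by (simp add: d_def complex_algebra.ev_mult)
  show thesis
  proof (rule that[OF 1])
    fix z
    assume z: "z \<in> S"
    have "cev (v * w) (cnj \<nu>) = 1" by (simp only: ev_complex_cnj 1 complex_cnj_one)
    then show "cev (v * w) z = (if z = \<nu> \<or> z = cnj \<nu> then 1 else 0)"
      using 1 w(2)[OF z] by (auto simp: complex_algebra.ev_mult)
  qed
qed

lemma algebra_homomorphism_iff:
  assumes "vector_space s1" "vector_space s2"
  shows "algebra_homomorphism s1 s2 h \<longleftrightarrow>
    (\<forall>a b. h (a + b) = h a + h b) \<and> (\<forall>c a. h (s1 c a) = s2 c (h a)) \<and> (\<forall>a b. h (a * b) = h a * h b)"
  unfolding algebra_homomorphism_def module_hom_iff_linear[symmetric] module_hom_def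
    module_hom_axioms_def module_iff_vector_space
  using assms by blast

context commutative_real_algebra
begin

lemma algebra_homomorphism_complex_iff:
  "algebra_homomorphism scale (scaleR :: real \<Rightarrow> complex \<Rightarrow> complex) h \<longleftrightarrow>
    (\<forall>a b. h (a + b) = h a + h b) \<and> (\<forall>c a. h (c \<cdot> a) = c *\<^sub>R h a) \<and> (\<forall>a b. h (a * b) = h a * h b)"
  by (rule algebra_homomorphism_iff) unfold_locales

end

context multiplicative_form
begin

lemma in_kernel_if_ev_zero:
  assumes "\<And>z. z \<in># spec a \<Longrightarrow> cev q z = 0"
  shows "ev q a \<in> kernel"
  by (rule kernel_if_spec_zero) (use assms in \<open>auto simp: spec_ev\<close>)

text \<open>Modulo the kernel \<open>ev q a\<close> is an idempotent \<open>e\<close>, and the new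
  map is \<open>\<phi>\<close> on the corner cut out by \<open>e\<close>, padded with
  \<open>1 - e\<close>. Its degree is found on scalars: by \<open>phi_ev\<close>, each spectral
  value with \<open>cev q z = 1\<close> contributes one factor \<open>t\<close>.\<close>

lemma corner_form:
  assumes q: "\<And>z. z \<in># spec a \<Longrightarrow> cev q z \<in> {0, 1}"
  shows "multiplicative_form scale (\<lambda>x. \<phi> (x * ev q a + (1 - ev q a)))
    (size {#z \<in># spec a. cev q z = 1#})"
proof
  define e where "e = ev q a"
  have idem: "e * e - e \<in> kernel"
    using in_kernel_if_ev_zero[of a "q * q - q"] q
    by (fastforce simp: e_def ev_mult ev_diff complex_algebra.ev_mult complex_algebra.ev_diff)
  define f where "f x = \<phi> (x * e + (1 - e))" for x
  have f_mult: "f (x * y) = f x * f y" for x y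
  proof -
    \<comment> \<open>The defect of multiplicativity is a multiple of
      \<open>e * e - e\<close>.\<close>
    have "(x * e + (1 - e)) * (y * e + (1 - e)) - (x * y * e + (1 - e)) =
        (e * e - e) * (x * y - x - y + 1)"
      by (simp add: algebra_simps)
    then have "(x * e + (1 - e)) * (y * e + (1 - e)) - (x * y * e + (1 - e)) \<in> kernel"
      using kernel_mult[OF idem] by simp
    then show ?thesis
      unfolding f_def phi_mult[symmetric] by (rule phi_cong[symmetric])
  qed
  have prod_if: "(\<Prod>z\<in>#M. if cev q z = 1 then of_real t else 1) =
      (of_real t ^ size {#z \<in># M. cev q z = 1#} :: complex)" for t :: real and M
    by (induction M) simp_all
  have f_scalar: "f (t \<cdot> 1) = of_real t ^ size {#z \<in># spec a. cev q z = 1#}" for t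
  proof -
    have "f (t \<cdot> 1) = \<phi> (ev (smult t q + (1 - q)) a)"
      by (simp add: f_def e_def ev_add ev_diff ev_smult scale_one_mult)
    also have "\<dots> = (\<Prod>z\<in>#spec a. if cev q z = 1 then of_real t else 1)"
      unfolding phi_ev using q
      by (intro arg_cong[where f = prod_mset] image_mset_cong)
        (fastforce simp: complex_algebra.ev_add complex_algebra.ev_diff complex_algebra.ev_smult scaleR_conv_of_real)
    also have "\<dots> = of_real t ^ size {#z \<in># spec a. cev q z = 1#}"
      by (rule prod_if)
    finally show ?thesis .
  qed
  show "\<phi> (x * y * ev q a + (1 - ev q a)) =
      \<phi> (x * ev q a + (1 - ev q a)) * \<phi> (y * ev q a + (1 - ev q a))" for x y
    using f_mult[of x y] by (simp add: f_def e_def)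
  show "\<phi> (1 * ev q a + (1 - ev q a)) = 1" by (simp add: phi_one)
  have "form (size {#z \<in># spec a. cev q z = 1#}) f"
    unfolding form_def
  proof (intro conjI allI impI)
    show "f (t \<cdot> x) = of_real t ^ size {#z \<in># spec a. cev q z = 1#} * f x" for t x
      using f_mult[of "t \<cdot> 1" x] by (simp add: f_scalar scale_one_mult)
  next
    fix x y
    have "f (x + s \<cdot> y) = poly (line \<phi> (x * e + (1 - e)) (y * e)) (of_real s)" for s
      by (simp add: f_def poly_phi distrib_right scale_mult_left add_ac)
    then show "\<exists>p. \<forall>s. f (x + s \<cdot> y) = poly p (of_real s)" by blast
  qed
  then show "form (size {#z \<in># spec a. cev q z = 1#}) (\<lambda>x. \<phi> (x * ev q a + (1 - ev q a)))"
    by (simp add: f_def[abs_def] e_def)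
qed

text \<open>\<open>corner_form\<close> is applied to the indicator \<open>q\<close> of
  \<open>\<nu>\<close> and its conjugate, and to \<open>1 - q\<close>. As \<open>\<nu>\<close> and
  \<open>\<mu>\<close> are on different sides, both degrees are positive and hence below
  \<open>N\<close>.\<close>

lemma split_form:
  assumes "\<nu> \<in># spec a" "\<mu> \<in># spec a" "\<mu> \<noteq> \<nu>" "\<mu> \<noteq> cnj \<nu>"
  obtains \<phi>1 \<phi>2 n1 n2 where "multiplicative_form scale \<phi>1 n1" "multiplicative_form scale \<phi>2 n2"
    "n1 < N" "n2 < N" "n1 + n2 = N" "\<And>x. \<phi> x = \<phi>1 x * \<phi>2 x"
proof -
  obtain q where q: "\<And>z. z \<in># spec a \<Longrightarrow> cev q z = (if z = \<nu> \<or> z = cnj \<nu> then 1 else 0)"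
    using separating_real_poly[OF finite_set_mset[of "spec a"]] by metis
  define e where "e = ev q a"
  define n1 where "n1 = size {#z \<in># spec a. cev q z = 1#}"
  define n2 where "n2 = size {#z \<in># spec a. cev (1 - q) z = 1#}"
  have "{#z \<in># spec a. cev (1 - q) z = 1#} = {#z \<in># spec a. cev q z \<noteq> 1#}"
    by (rule filter_mset_cong) (auto simp: q complex_algebra.ev_diff)
  then have sum: "n1 + n2 = N"
    by (simp add: n1_def n2_def size_spec flip: size_union multiset_partition)
  have "\<nu> \<in># {#z \<in># spec a. cev q z = 1#}" "\<mu> \<in># {#z \<in># spec a. cev (1 - q) z = 1#}"
    using assms q by (auto simp: complex_algebra.ev_diff)
  then have "n1 > 0" "n2 > 0"
    unfolding n1_def n2_def by (auto simp: nonempty_has_size[symmetric])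
  have form1: "multiplicative_form scale (\<lambda>x. \<phi> (x * e + (1 - e))) n1"
    unfolding e_def n1_def by (rule corner_form) (auto simp: q)
  have form2: "multiplicative_form scale (\<lambda>x. \<phi> (x * (1 - e) + e)) n2"
  proof -
    have "multiplicative_form scale (\<lambda>x. \<phi> (x * ev (1 - q) a + (1 - ev (1 - q) a))) n2"
      unfolding n2_def by (rule corner_form) (auto simp: q complex_algebra.ev_diff)
    then show ?thesis by (simp add: e_def ev_diff)
  qed
  have factor: "\<phi> x = \<phi> (x * e + (1 - e)) * \<phi> (x * (1 - e) + e)" for x
  proof -
    have "e * e - e \<in> kernel"
      using in_kernel_if_ev_zero[of a "q * q - q"] q
      by (fastforce simp: e_def ev_mult ev_diff complex_algebra.ev_mult complex_algebra.ev_diff)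
    then have "(e * e - e) * (- (x * x) + x + x - 1) \<in> kernel" by (rule kernel_mult)
    also have "(e * e - e) * (- (x * x) + x + x - 1) = (x * e + (1 - e)) * (x * (1 - e) + e) - x"
      by (simp add: algebra_simps)
    finally show ?thesis using phi_cong phi_mult by metis
  qed
  show thesis
    using \<open>n1 > 0\<close> \<open>n2 > 0\<close> sum by (intro that[OF form1 form2 _ _ sum factor]) simp_all
qed

text \<open>For a nonzero \<open>\<nu>\<close> in the spectrum of \<open>x\<close>,
  \<open>ev (norm_poly \<nu>) x\<close> lies in the kernel. Multiplied by \<open>y\<close> it loses
  all terms containing \<open>x * y\<close>, which leaves the nonzero multiple
  \<open>m \<cdot> y\<close>.\<close>

lemma kernel_prime:
  assumes nosplit: "\<And>a \<nu> \<mu>. \<nu> \<in># spec a \<Longrightarrow> \<mu> \<in># spec a \<Longrightarrow> \<mu> = \<nu> \<or> \<mu> = cnj \<nu>"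
    and "x * y \<in> kernel" "x \<notin> kernel"
  shows "y \<in> kernel"
proof -
  obtain \<nu> where \<nu>: "\<nu> \<in># spec x" "\<nu> \<noteq> 0"
    using kernel_if_spec_zero[of x] assms(3) by auto
  define m where "m = (Re \<nu>)\<^sup>2 + (Im \<nu>)\<^sup>2"
  have "m \<noteq> 0" using \<nu>(2) by (simp add: m_def complex_eq_iff sum_power2_eq_zero_iff)
  have "ev (norm_poly \<nu>) x \<in> kernel"
    using nosplit[OF \<nu>(1)] by (intro in_kernel_if_ev_zero) (auto simp: ev_norm_poly)
  then have "y * ev (norm_poly \<nu>) x - (x * y) * ((- 2 * Re \<nu>) \<cdot> 1 + x) \<in> kernel"
    by (intro kernel_diff kernel_mult' kernel_mult assms(2))
  also have "y * ev (norm_poly \<nu>) x - (x * y) * ((- 2 * Re \<nu>) \<cdot> 1 + x) = m \<cdot> y"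
    by (simp add: norm_poly_def m_def algebra_simps flip: scale_mult_right scale_mult_left)
  finally show ?thesis
    using kernel_scale[of "m \<cdot> y" "1 / m"] \<open>m \<noteq> 0\<close> by simp
qed

text \<open>The two cases of the quotient by the kernel being \<open>\<real>\<close> (\<open>is_real\<close> holds) or \<open>\<complex>\<close>,
  with \<open>J\<close> the imaginary unit in the second case.\<close>

lemma characters_from_section:
  assumes "N > 0"
    and J: "is_real \<or> J * J + 1 \<in> kernel \<and> set_mset (spec J) \<subseteq> {\<i>, - \<i>}"
    and cover: "\<And>b. \<exists>z. (is_real \<longrightarrow> Im z = 0) \<and> b - ev [:Re z, Im z:] J \<in> kernel"
  shows "\<exists>hs. length hs = N \<and>
    (\<forall>h\<in>set hs. algebra_homomorphism scale (scaleR :: real \<Rightarrow> complex \<Rightarrow> complex) h) \<and>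
    (\<forall>a. \<phi> a = (\<Prod>h\<leftarrow>hs. h a))"
proof -
  define \<iota> where "\<iota> z = ev [:Re z, Im z:] J" for z
  have \<iota>: "\<iota> z = Re z \<cdot> 1 + Im z \<cdot> J" for z
    by (simp add: \<iota>_def flip: scale_mult_right)
  have spec_\<iota>: "spec (\<iota> z) = image_mset (\<lambda>w. of_real (Re z) + w * of_real (Im z)) (spec J)" for z
    unfolding \<iota>_def spec_ev by (intro image_mset_cong) (simp add: scaleR_conv_of_real)
  \<comment> \<open>A kernel element has only the spectral value 0, whereas \<open>\<iota> z\<close>
    has the values Re z + w Im z with \<open>w\<close> in the spectrum of \<open>J\<close>.\<close>
  have inj: "z = 0" if "\<iota> z \<in> kernel" "is_real \<longrightarrow> Im z = 0" for z
  proof -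
    obtain w where w: "w \<in># spec J"
      using size_spec[of J] assms(1) by (metis multiset_nonemptyE size_empty less_irrefl)
    then have "of_real (Re z) + w * of_real (Im z) \<in># spec (\<iota> z)"
      unfolding spec_\<iota> by auto
    then have "of_real (Re z) + w * of_real (Im z) = (0 :: complex)"
      unfolding spec_kernel[OF that(1)] by (simp split: if_splits)
    then show ?thesis
      using J that(2) w by (cases is_real) (auto simp: complex_eq_iff)
  qed
  obtain \<xi> where is_real: "\<And>b. is_real \<Longrightarrow> Im (\<xi> b) = 0" and \<xi>: "\<And>b. b - \<iota> (\<xi> b) \<in> kernel"
    using cover unfolding \<iota>_def by metis
  have unique: "\<xi> b = z" if "b - \<iota> z \<in> kernel" "is_real \<longrightarrow> Im z = 0" for b z
  proof -
    have "(b - \<iota> z) - (b - \<iota> (\<xi> b)) \<in> kernel" by (intro kernel_diff that \<xi>)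
    also have "(b - \<iota> z) - (b - \<iota> (\<xi> b)) = \<iota> (\<xi> b - z)"
      by (simp add: \<iota> algebra_simps)
    finally show ?thesis using inj[of "\<xi> b - z"] that(2) is_real by simp
  qed
  have add: "\<xi> (a + b) = \<xi> a + \<xi> b" for a b
  proof (rule unique)
    have "(a - \<iota> (\<xi> a)) + (b - \<iota> (\<xi> b)) \<in> kernel" by (intro kernel_add \<xi>)
    then show "a + b - \<iota> (\<xi> a + \<xi> b) \<in> kernel" by (simp add: \<iota> algebra_simps)
  qed (simp add: is_real)
  have scale: "\<xi> (c \<cdot> a) = c *\<^sub>R \<xi> a" for c a
  proof (rule unique)
    have "c \<cdot> (a - \<iota> (\<xi> a)) \<in> kernel" by (intro kernel_scale \<xi>)
    then show "c \<cdot> a - \<iota> (c *\<^sub>R \<xi> a) \<in> kernel"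
      by (simp add: \<iota> scale_right_distrib scale_right_diff_distrib)
  qed (simp add: is_real)
  have mult: "\<xi> (a * b) = \<xi> a * \<xi> b" for a b
  proof (rule unique)
    \<comment> \<open>This is the error in \<open>\<iota> (\<xi> a) * \<iota> (\<xi> b)\<close>
      against \<open>\<iota> (\<xi> a * \<xi> b)\<close>; in the real case its coefficient is
      zero.\<close>
    have "(Im (\<xi> a) * Im (\<xi> b)) \<cdot> (J * J + 1) \<in> kernel"
      using J is_real[of a] by (cases is_real) (auto intro: kernel_scale kernel_0)
    then have "((a - \<iota> (\<xi> a)) * b + \<iota> (\<xi> a) * (b - \<iota> (\<xi> b))) +
        (Im (\<xi> a) * Im (\<xi> b)) \<cdot> (J * J + 1) \<in> kernel"
      by (intro kernel_add kernel_mult kernel_mult' \<xi>)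
    also have "((a - \<iota> (\<xi> a)) * b + \<iota> (\<xi> a) * (b - \<iota> (\<xi> b))) +
        (Im (\<xi> a) * Im (\<xi> b)) \<cdot> (J * J + 1) = a * b - \<iota> (\<xi> a * \<xi> b)"
      by (simp add: \<iota> algebra_simps flip: scale_mult_right scale_mult_left)
    finally show "a * b - \<iota> (\<xi> a * \<xi> b) \<in> kernel" .
  qed (simp add: is_real)
  \<comment> \<open>Each spectral value \<open>w\<close> of \<open>J\<close>, with multiplicity,
    gives one factor: \<open>J\<close> is replaced by \<open>w\<close>.\<close>
  define h where "h w b = of_real (Re (\<xi> b)) + w * of_real (Im (\<xi> b))" for w :: complex and b
  have hom: "algebra_homomorphism scale (scaleR :: real \<Rightarrow> complex \<Rightarrow> complex) (h w)" if "w \<in># spec J" for w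
  proof -
    have "is_real \<or> w = \<i> \<or> w = - \<i>" using J that by blast
    then have "h w = \<xi> \<or> h w = (\<lambda>b. cnj (\<xi> b))"
      by (auto simp: h_def fun_eq_iff complex_eq_iff is_real)
    moreover have "algebra_homomorphism scale (scaleR :: real \<Rightarrow> complex \<Rightarrow> complex) \<xi>"
      "algebra_homomorphism scale (scaleR :: real \<Rightarrow> complex \<Rightarrow> complex) (\<lambda>b. cnj (\<xi> b))"
      by (simp_all add: algebra_homomorphism_complex_iff add scale mult)
    ultimately show ?thesis by metis
  qed
  obtain ws where ws: "mset ws = spec J" using ex_mset by blast
  have "\<phi> a = (\<Prod>w\<leftarrow>ws. h w a)" for a
  proof -
    have "\<phi> a = \<phi> (\<iota> (\<xi> a))" by (rule phi_cong[OF \<xi>])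
    also have "\<dots> = (\<Prod>w\<in>#spec J. h w a)"
      unfolding \<iota>_def phi_ev
      by (intro arg_cong[where f = prod_mset] image_mset_cong) (simp add: h_def scaleR_conv_of_real)
    finally show ?thesis by (simp flip: ws mset_map prod_mset_prod_list)
  qed
  moreover have "length ws = N" using size_spec[of J] by (simp flip: ws)
  moreover have "\<forall>w\<in>set ws. algebra_homomorphism scale (scaleR :: real \<Rightarrow> complex \<Rightarrow> complex) (h w)"
    using hom by (simp flip: ws)
  ultimately show ?thesis by (intro exI[of _ "map h ws"]) (simp add: o_def)
qed

text \<open>If all spectra are real, every element is a scalar modulo the kernel. Otherwise a
  nonreal spectral value yields \<open>J\<close>, and \<open>ev (norm_poly z) b\<close> factors
  modulo the kernel into \<open>b\<close> minus the two elements representing \<open>z\<close> and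
  \<open>cnj z\<close>; \<open>kernel_prime\<close> selects one of them.\<close>

lemma characters_of_unsplit_form:
  assumes "N > 0"
    and nosplit: "\<And>a \<nu> \<mu>. \<nu> \<in># spec a \<Longrightarrow> \<mu> \<in># spec a \<Longrightarrow> \<mu> = \<nu> \<or> \<mu> = cnj \<nu>"
  shows "\<exists>hs. length hs = N \<and>
    (\<forall>h\<in>set hs. algebra_homomorphism scale (scaleR :: real \<Rightarrow> complex \<Rightarrow> complex) h) \<and>
    (\<forall>a. \<phi> a = (\<Prod>h\<leftarrow>hs. h a))"
proof -
  have nonempty: "\<exists>z. z \<in># spec b" for b
    using size_spec[of b] assms(1) by (metis multiset_nonemptyE size_empty less_irrefl)
  show ?thesis
  proof (cases "\<forall>b. \<forall>z\<in>#spec b. Im z = 0")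
    case True
    show ?thesis
    proof (rule characters_from_section[OF assms(1), where is_real = True and J = 0])
      fix b
      obtain z where z: "z \<in># spec b" using nonempty by blast
      have "ev [:- Re z, 1:] b \<in> kernel"
        using nosplit[OF z] True by (intro in_kernel_if_ev_zero) (auto simp: complex_eq_iff)
      then show "\<exists>z. (True \<longrightarrow> Im z = 0) \<and> b - ev [:Re z, Im z:] 0 \<in> kernel"
        using True z by (intro exI[of _ z]) simp
    qed simp
  next
    case False
    then obtain a \<nu> where \<nu>: "\<nu> \<in># spec a" "Im \<nu> \<noteq> 0" by blast
    define J where "J = ev [:- Re \<nu> / Im \<nu>, 1 / Im \<nu>:] a"
    have "cev [:- Re \<nu> / Im \<nu>, 1 / Im \<nu>:] z \<in> {\<i>, - \<i>}" if "z \<in># spec a" for z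
      using nosplit[OF \<nu>(1) that] \<nu>(2) by (auto simp: complex_eq_iff field_simps)
    then have spec_J: "set_mset (spec J) \<subseteq> {\<i>, - \<i>}"
      unfolding J_def spec_ev by auto
    have "ev [:1, 0, 1:] J \<in> kernel"
      using spec_J by (intro in_kernel_if_ev_zero) (auto simp: complex_eq_iff)
    then have J2: "J * J + 1 \<in> kernel" by (simp add: add.commute)
    show ?thesis
    proof (rule characters_from_section[OF assms(1), where is_real = False and J = J])
      fix b
      obtain z where z: "z \<in># spec b" using nonempty by blast
      have "ev (norm_poly z) b \<in> kernel"
        using nosplit[OF z] by (intro in_kernel_if_ev_zero) (auto simp: ev_norm_poly)
      then have "ev (norm_poly z) b - (Im z)\<^sup>2 \<cdot> (J * J + 1) \<in> kernel"
        by (intro kernel_diff kernel_scale J2)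
      also have "ev (norm_poly z) b = (b - Re z \<cdot> 1) * (b - Re z \<cdot> 1) + (Im z)\<^sup>2 \<cdot> 1"
      proof -
        have "norm_poly z = [:- Re z, 1:] * [:- Re z, 1:] + [:(Im z)\<^sup>2:]"
          by (simp add: norm_poly_def power2_eq_square)
        then show ?thesis by (simp add: ev_add ev_mult del: mult_pCons_left mult_pCons_right)
      qed
      also have "\<dots> - (Im z)\<^sup>2 \<cdot> (J * J + 1) =
          (b - Re z \<cdot> 1) * (b - Re z \<cdot> 1) - (Im z \<cdot> J) * (Im z \<cdot> J)"
        by (simp add: scale_right_distrib power2_eq_square flip: scale_mult_right scale_mult_left)
      also have "\<dots> = (b - Re z \<cdot> 1 - Im z \<cdot> J) * (b - Re z \<cdot> 1 + Im z \<cdot> J)"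
        by (simp add: ring_distribs mult.commute)
      also have "\<dots> = (b - ev [:Re z, Im z:] J) * (b - ev [:Re (cnj z), Im (cnj z):] J)"
        by (intro arg_cong2[where f = times]) (simp_all add: algebra_simps flip: scale_mult_right)
      finally show "\<exists>z. (False \<longrightarrow> Im z = 0) \<and> b - ev [:Re z, Im z:] J \<in> kernel"
        using kernel_prime nosplit by blast
    qed (use spec_J J2 in simp)
  qed
qed

end

context commutative_real_algebra
begin

lemma multiplicative_form_eq_prod_characters:
  assumes "multiplicative_form scale \<phi> N"
  shows "\<exists>hs. length hs = N \<and>
    (\<forall>h\<in>set hs. algebra_homomorphism scale (scaleR :: real \<Rightarrow> complex \<Rightarrow> complex) h) \<and>
    (\<forall>a. \<phi> a = (\<Prod>h\<leftarrow>hs. h a))"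
  using assms
proof (induction N arbitrary: \<phi> rule: less_induct)
  case (less N)
  interpret multiplicative_form scale \<phi> N by (rule less.prems)
  show ?case
  proof (cases "N = 0")
    case True
    \<comment> \<open>In degree 0, \<open>0 \<cdot> a = 0\<close> and \<open>0 ^ 0 = 1\<close> make
      \<open>\<phi>\<close> constant.\<close>
    have "\<phi> a = 1" for a
      using form_scale_any[OF phi_form, of 0 a] form_scale_any[OF phi_form, of 0 1]
      by (simp add: True phi_one)
    then show ?thesis using True by simp
  next
    case N: False
    show ?thesis
    proof (cases "\<exists>a \<nu> \<mu>. \<nu> \<in># spec a \<and> \<mu> \<in># spec a \<and> \<mu> \<noteq> \<nu> \<and> \<mu> \<noteq> cnj \<nu>")
      case True
      then obtain \<phi>1 \<phi>2 n1 n2 where split: "multiplicative_form scale \<phi>1 n1"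
        "multiplicative_form scale \<phi>2 n2" "n1 < N" "n2 < N" "n1 + n2 = N" "\<And>x. \<phi> x = \<phi>1 x * \<phi>2 x"
        by (elim exE conjE) (rule split_form; blast)
      from less.IH[OF split(3,1)] less.IH[OF split(4,2)] obtain hs1 hs2
        where "length hs1 = n1" "\<forall>h\<in>set hs1. algebra_homomorphism scale (scaleR :: real \<Rightarrow> complex \<Rightarrow> complex) h"
          "\<forall>a. \<phi>1 a = (\<Prod>h\<leftarrow>hs1. h a)"
          "length hs2 = n2" "\<forall>h\<in>set hs2. algebra_homomorphism scale (scaleR :: real \<Rightarrow> complex \<Rightarrow> complex) h"
          "\<forall>a. \<phi>2 a = (\<Prod>h\<leftarrow>hs2. h a)"
        by auto
      then show ?thesis
        using split(5,6) by (intro exI[of _ "hs1 @ hs2"]) auto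
    next
      case False
      then show ?thesis using N by (intro characters_of_unsplit_form) blast+
    qed
  qed
qed

end

section \<open>Polynomial maps and continuity of characters\<close>

text \<open>This shape, an arbitrary prefix followed by a diagonal, lets the next two lemmas expand
  one argument at a time.\<close>

lemma multilinear_step:
  assumes "multilinear s1 s2 d m" "length xs + Suc k = d"
  shows "m (xs @ (a + s1 c b) # replicate k y) = m (xs @ a # replicate k y) + s2 c (m (xs @ b # replicate k y))"
    and "m (xs @ 0 # replicate k y) = 0"
proof -
  have "Vector_Spaces.linear s1 s2 (\<lambda>x. m (xs @ x # replicate k y))"
    using assms(1)[unfolded multilinear_def, rule_format, of "xs @ 0 # replicate k y" "length xs"] assms(2)
    by simp
  then have hom: "module_hom s1 s2 (\<lambda>x. m (xs @ x # replicate k y))"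
    by (simp add: module_hom_iff_linear)
  show "m (xs @ (a + s1 c b) # replicate k y) =
      m (xs @ a # replicate k y) + s2 c (m (xs @ b # replicate k y))"
    "m (xs @ 0 # replicate k y) = 0"
    by (simp_all add: module_hom.add[OF hom] module_hom.scale[OF hom] module_hom.zero[OF hom])
qed

text \<open>\<open>\<kappa>\<close> stands for the embedding of the scalars into the complex
  numbers, so that real and complex polynomial maps are treated together.\<close>

lemma multilinear_line:
  fixes \<kappa> :: "'k::field \<Rightarrow> complex"
  assumes "multilinear s1 (\<lambda>c z. \<kappa> c * z) d m" "length xs + k = d"
  shows "\<exists>p. \<forall>c. m (xs @ replicate k (a + s1 c b)) = poly p (\<kappa> c)"
  using assms(2)
proof (induction k arbitrary: xs)
  case 0
  show ?case by (rule exI[of _ "[:m xs:]"]) simp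
next
  case (Suc k)
  obtain p q where "\<And>c. m ((xs @ [a]) @ replicate k (a + s1 c b)) = poly p (\<kappa> c)"
    "\<And>c. m ((xs @ [b]) @ replicate k (a + s1 c b)) = poly q (\<kappa> c)"
    using Suc.IH[of "xs @ [a]"] Suc.IH[of "xs @ [b]"] Suc.prems by auto
  then show ?case
    using multilinear_step(1)[OF assms(1) Suc.prems]
    by (intro exI[of _ "p + pCons 0 q"]) simp
qed

lemma multilinear_scale:
  assumes m: "multilinear s1 (\<lambda>c z. \<kappa> c * z :: complex) d m" and "length xs + k = d"
    and "vector_space s1"
  shows "m (xs @ replicate k (s1 c a)) = \<kappa> c ^ k * m (xs @ replicate k a)"
  using assms(2)
proof (induction k arbitrary: xs)
  case (Suc k)
  have "m (xs @ (s1 c a) # replicate k y) = \<kappa> c * m (xs @ a # replicate k y)" for y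
    using multilinear_step(1)[OF m Suc.prems, of 0 c a y] multilinear_step(2)[OF m Suc.prems] by simp
  then show ?case
    using Suc.IH[of "xs @ [a]"] Suc.prems by simp
qed simp

text \<open>Comparing coefficients of \<open>r\<close> in the identity of \<open>\<phi>\<close> at
  \<open>r a\<close> with \<open>\<phi>\<close> at \<open>r 1\<close> times \<open>\<phi> a\<close>
  gives \<open>p d a = p d 1 * \<phi> a\<close>. As \<open>p N\<close> is nonzero,
  \<open>p N 1 \<noteq> 0\<close>, so \<open>\<phi>\<close> is a multiple of \<open>p N\<close> and
  inherits its homogeneity.\<close>

lemma multiplicative_polynomial_map:
  fixes scale :: "'k::real_normed_field \<Rightarrow> 'a::{comm_ring, comm_monoid_mult} \<Rightarrow> 'a"
    and \<kappa> :: "'k \<Rightarrow> complex"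
    and \<phi> :: "'a \<Rightarrow> complex"
  assumes poly: "polynomial_map_of_degree scale (\<lambda>c z. \<kappa> c * z) N \<phi>"
    and \<kappa>: "\<And>r. \<kappa> (of_real r) = of_real r"
    and "vector_space scale" and scale_mult: "\<And>c a b. scale c (a * b) = scale c a * b"
    and mult: "\<And>a b. \<phi> (a * b) = \<phi> a * \<phi> b"
  shows "\<phi> 1 = 1" "\<phi> (scale c a) = \<kappa> c ^ N * \<phi> a"
    "\<exists>q. \<forall>r. \<phi> (a + scale (of_real r) b) = poly q (of_real r)"
proof -
  obtain p x where p: "\<And>d. d \<le> N \<Longrightarrow> homogeneous_polynomial scale (\<lambda>c z. \<kappa> c * z) d (p d)"
    and x: "p N x \<noteq> 0" and \<phi>: "\<And>x. \<phi> x = (\<Sum>d\<le>N. p d x)"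
    using poly unfolding polynomial_map_of_degree_def by blast
  have p_scale: "p d (scale c a) = \<kappa> c ^ d * p d a" if "d \<le> N" for d c a
    using p[OF that] multilinear_scale[OF _ _ assms(3), of \<kappa> d _ "[]" d]
    unfolding homogeneous_polynomial_def by fastforce
  have scale_one_mult: "scale c 1 * a = scale c a" for c a
    by (simp flip: scale_mult)
  have p_eq: "p d a = p d 1 * \<phi> a" if "d \<le> N" for d a
  proof -
    have "(\<Sum>d\<le>N. monom (p d a) d) = (\<Sum>d\<le>N. monom (p d 1 * \<phi> a) d)"
    proof (rule complex_poly_eqI[OF infinite_UNIV_char_0])
      fix r :: real
      have "\<phi> (scale (of_real r) a) = \<phi> (scale (of_real r) 1) * \<phi> a"
        by (simp add: scale_one_mult flip: mult)
      then show "poly (\<Sum>d\<le>N. monom (p d a) d) (of_real r) =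
          poly (\<Sum>d\<le>N. monom (p d 1 * \<phi> a) d) (of_real r)"
        unfolding \<phi>[of "scale _ _"]
        by (simp add: p_scale \<kappa> poly_sum poly_monom sum_distrib_left mult_ac)
    qed
    then have "coeff (\<Sum>d\<le>N. monom (p d a) d) d = coeff (\<Sum>d\<le>N. monom (p d 1 * \<phi> a) d) d"
      by simp
    then show ?thesis using that by (simp add: coeff_sum)
  qed
  have top: "p N 1 \<noteq> 0" using p_eq[of N x] x by auto
  then show "\<phi> 1 = 1" using p_eq[of N 1] by simp
  have "\<phi> (scale c 1) = \<kappa> c ^ N"
    using p_eq[of N "scale c 1"] p_scale[of N c 1] top by simp
  then show "\<phi> (scale c a) = \<kappa> c ^ N * \<phi> a"
    by (simp flip: scale_one_mult[of c a] add: mult)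
  have "\<exists>q. \<forall>c. p d (a + scale c b) = poly q (\<kappa> c)" if "d \<le> N" for d
    using p[OF that] multilinear_line[of scale \<kappa> d _ "[]" d a b]
    unfolding homogeneous_polynomial_def by fastforce
  then obtain q where "\<And>d c. d \<le> N \<Longrightarrow> p d (a + scale c b) = poly (q d) (\<kappa> c)"
    by metis
  then have "\<phi> (a + scale (of_real r) b) = poly (\<Sum>d\<le>N. q d) (of_real r)" for r
    by (simp add: \<phi> poly_sum \<kappa>)
  then show "\<exists>q. \<forall>r. \<phi> (a + scale (of_real r) b) = poly q (of_real r)" by blast
qed

section \<open>Restriction to real scalars and continuity\<close>

lemma continuous_inverse_algebra_restrict_scalars:
  fixes scale :: "'k::real_normed_field \<Rightarrow> 'a::{ring, monoid_mult, topological_ab_group_add, topological_semigroup_mult} \<Rightarrow> 'a"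
  assumes "continuous_inverse_algebra scale"
  shows "continuous_inverse_algebra (\<lambda>r::real. scale (of_real r))"
proof -
  interpret continuous_inverse_algebra scale by fact
  show ?thesis
  proof
    show "continuous_on UNIV (\<lambda>(r::real, a). scale (of_real r) a)"
    proof -
      have "continuous_on UNIV (\<lambda>p :: real \<times> 'a. (of_real (fst p) :: 'k, snd p))"
        by (intro continuous_intros)
      from continuous_on_compose2[OF continuous_scale this] show ?thesis
        by (simp add: case_prod_unfold)
    qed
    show "scale (of_real c) (a * b) = a * scale (of_real c) b" for c :: real and a b
      by (rule scale_mult_right)
  qed (use locally_convex in \<open>simp_all add: scale_right_distrib scale_left_distrib
      scale_mult_left open_units continuous_inverse\<close>)
qed

lemma character_continuous:
  fixes scale :: "real \<Rightarrow> 'a::{comm_ring, comm_monoid_mult, topological_ab_group_add, topological_semigroup_mult} \<Rightarrow> 'a"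
  assumes "continuous_inverse_algebra scale"
    and hom: "algebra_homomorphism scale (scaleR :: real \<Rightarrow> complex \<Rightarrow> complex) h"
  shows "continuous_on UNIV h"
\<comment> \<open>Homomorphisms need not be unital; if \<open>h 1 = 0\<close>, then \<open>h\<close>
  is zero.\<close>
proof (cases "h 1 = 0")
  case True
  have "h a = 0" for a
    using hom True unfolding algebra_homomorphism_def by (metis mult_1_right mult_zero_right)
  then show ?thesis by simp
next
  case False
  interpret continuous_inverse_algebra scale by fact
  interpret commutative_real_algebra scale by unfold_locales (rule scale_mult_left)
  have h: "h (a + b) = h a + h b" "h (scale c a) = c *\<^sub>R h a" "h (a * b) = h a * h b" for a b c
    using hom by (simp_all add: algebra_homomorphism_complex_iff)
  have h1: "h 1 = 1" using h(3)[of 1 1] False by simp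
  have h_diff: "h (a - b) = h a - h b" for a b
    using h(1)[of "a - b" b] by simp
  have cont: "continuous_on UNIV (\<lambda>a. scale c (f a))" if "continuous_on UNIV f" for c and f :: "'a \<Rightarrow> 'a"
  proof -
    have "continuous_on UNIV (\<lambda>a. (c, f a))"
      by (intro continuous_intros that)
    from continuous_on_compose2[OF continuous_scale this] show ?thesis by simp
  qed
  define U where "U = {a::'a. \<exists>b. a * b = 1 \<and> b * a = 1}"
  have U: "h a \<noteq> 0" if a: "a \<in> U" for a
  proof -
    obtain b where "a * b = 1" using a by (auto simp: U_def)
    then show ?thesis using h(3)[of a b] h1 by auto
  qed
  have "open ((\<lambda>p. 1 + fst p + snd p) -` U)"
    unfolding U_def by (intro open_vimage[OF open_units] continuous_intros)
  moreover have "(0, 0) \<in> (\<lambda>p. 1 + fst p + snd p) -` U"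
    by (simp add: U_def)
  ultimately obtain A B where AB: "open A" "open B" "0 \<in> A" "0 \<in> B" "A \<times> B \<subseteq> (\<lambda>p. 1 + fst p + snd p) -` U"
    by (auto elim!: open_prod_elim)
  define V where "V = A \<inter> B"
  have V: "open V" "0 \<in> V" "\<And>x y. x \<in> V \<Longrightarrow> y \<in> V \<Longrightarrow> 1 + x + y \<in> U"
    using AB by (auto simp: V_def)
  have "open ((\<lambda>(c, a). scale c a) -` V)" using open_vimage[OF V(1) continuous_scale] .
  moreover have "(0, 0) \<in> (\<lambda>(c, a). scale c a) -` V" using V(2) by simp
  ultimately obtain C W where CW: "open C" "open W" "0 \<in> C" "0 \<in> W" "C \<times> W \<subseteq> (\<lambda>(c, a). scale c a) -` V"
    by (auto elim!: open_prod_elim)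
  obtain \<delta> where \<delta>: "\<delta> > 0" "\<And>c. \<bar>c\<bar> < \<delta> \<Longrightarrow> c \<in> C"
    using CW(1,3) unfolding open_dist by (auto simp: dist_real_def)
  \<comment> \<open>The factor \<open>4 / \<delta>\<close> turns a coefficient up to 2 into one up
    to \<open>\<delta> / 2\<close>, which lies in \<open>C\<close>.\<close>
  have small: "scale c x \<in> V" if "scale (4 / \<delta>) x \<in> W" "\<bar>c\<bar> \<le> 2" for c x
  proof -
    have "\<bar>c * \<delta> / 4\<bar> < \<delta>" using that(2) \<delta>(1) by (simp add: abs_mult)
    then have "(c * \<delta> / 4, scale (4 / \<delta>) x) \<in> C \<times> W" using \<delta>(2) that(1) by auto
    then have "scale (c * \<delta> / 4) (scale (4 / \<delta>) x) \<in> V" using CW(5) by auto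
    then show ?thesis using \<delta>(1) by simp
  qed
  define Z where "Z = (\<lambda>a. scale (4 / \<delta>) a) -` W \<inter> (\<lambda>a. scale (4 / \<delta>) (a * a)) -` W"
  have Z: "open Z" "0 \<in> Z"
    unfolding Z_def using CW(2,4)
    by (auto intro!: open_Int open_vimage cont continuous_on_mult' continuous_intros)
  \<comment> \<open>Otherwise the quadratic annihilated by \<open>h\<close> is divided by
    \<open>m\<close>, its constant term. The other coefficients are then at most 2 in absolute
    value, so \<open>V\<close> makes it a unit.\<close>
  have bound: "cmod (h a) < 1" if "a \<in> Z" for a
  proof (rule ccontr)
    assume "\<not> cmod (h a) < 1"
    define m where "m = (cmod (h a))\<^sup>2"
    have "1 \<le> cmod (h a)" using \<open>\<not> cmod (h a) < 1\<close> by simp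
    then have m: "1 \<le> m" "cmod (h a) \<le> m" by (simp_all add: m_def self_le_power)
    have "\<bar>Re (h a)\<bar> \<le> m" using abs_Re_le_cmod[of "h a"] m by simp
    then have "\<bar>- (2 * Re (h a) / m)\<bar> \<le> 2" "\<bar>1 / m\<bar> \<le> 2"
      using m by (simp_all add: abs_mult divide_simps)
    then have "1 + scale (- (2 * Re (h a) / m)) a + scale (1 / m) (a * a) \<in> U"
      using that by (intro V(3) small) (auto simp: Z_def)
    then have "h (1 + scale (- (2 * Re (h a) / m)) a + scale (1 / m) (a * a)) \<noteq> 0" by (rule U)
    moreover have "of_real m = h a * cnj (h a)"
      by (simp add: m_def complex_norm_square[symmetric])
    then have "of_real m + of_real (- 2 * Re (h a)) * h a + h a * h a = 0"
      by (simp add: complex_eq_iff algebra_simps)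
    moreover have "h (1 + scale (- (2 * Re (h a) / m)) a + scale (1 / m) (a * a)) =
        (of_real m + of_real (- 2 * Re (h a)) * h a + h a * h a) / of_real m"
      unfolding h h1 using m(1) by (simp add: scaleR_conv_of_real add_divide_distrib diff_divide_distrib)
    ultimately show False by simp
  qed
  show ?thesis
    unfolding continuous_on_def
  proof (intro ballI tendstoI)
    fix x :: 'a and \<epsilon> :: real
    assume \<epsilon>: "\<epsilon> > 0"
    have "open ((\<lambda>a. scale (1 / \<epsilon>) (a - x)) -` Z)"
      by (intro open_vimage Z cont continuous_intros)
    moreover have "x \<in> (\<lambda>a. scale (1 / \<epsilon>) (a - x)) -` Z" using Z by simp
    moreover have "dist (h a) (h x) < \<epsilon>" if "a \<in> (\<lambda>a. scale (1 / \<epsilon>) (a - x)) -` Z" for a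
    proof -
      have "cmod ((1 / \<epsilon>) *\<^sub>R (h a - h x)) < 1"
        using bound[of "scale (1 / \<epsilon>) (a - x)"] that by (simp only: h h_diff vimage_eq)
      then show ?thesis
        using \<epsilon> unfolding norm_scaleR dist_norm by (simp add: field_simps)
    qed
    ultimately show "\<forall>\<^sub>F a in at x within UNIV. dist (h a) (h x) < \<epsilon>"
      unfolding eventually_at_topological by blast
  qed
qed

lemma multiplicative_form_continuous_characters:
  fixes scale :: "real \<Rightarrow> 'a::{comm_ring, comm_monoid_mult, topological_ab_group_add, topological_semigroup_mult} \<Rightarrow> 'a"
  assumes cia: "continuous_inverse_algebra scale"
    and "\<And>a b. \<phi> (a * b) = \<phi> a * \<phi> b" "\<phi> 1 = 1" "\<And>c a. \<phi> (scale c a) = of_real c ^ N * \<phi> a"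
    and "\<And>a b. \<exists>q. \<forall>r. \<phi> (a + scale r b) = poly q (of_real r)"
  shows "\<exists>\<psi> :: nat \<Rightarrow> 'a \<Rightarrow> complex.
    (\<forall>i\<in>{1..N}. continuous_on UNIV (\<psi> i) \<and>
      algebra_homomorphism scale (scaleR :: real \<Rightarrow> complex \<Rightarrow> complex) (\<psi> i)) \<and>
    (\<forall>a. \<phi> a = (\<Prod>i=1..N. \<psi> i a))"
proof -
  interpret continuous_inverse_algebra scale by fact
  interpret commutative_real_algebra scale by unfold_locales (rule scale_mult_left)
  have "multiplicative_form scale \<phi> N"
    by unfold_locales (use assms in \<open>simp_all add: form_def\<close>)
  from multiplicative_form_eq_prod_characters[OF this] obtain hs where hs: "length hs = N"
    "\<And>h. h \<in> set hs \<Longrightarrow> algebra_homomorphism scale (scaleR :: real \<Rightarrow> complex \<Rightarrow> complex) h"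
    "\<And>a. \<phi> a = (\<Prod>h\<leftarrow>hs. h a)"
    by blast
  show ?thesis
  proof (intro exI[of _ "\<lambda>i. hs ! (i - 1)"] conjI ballI allI)
    fix i
    assume "i \<in> {1..N}"
    then have "hs ! (i - 1) \<in> set hs" using hs(1) by auto
    from hs(2)[OF this] show
      "algebra_homomorphism scale (scaleR :: real \<Rightarrow> complex \<Rightarrow> complex) (hs ! (i - 1))"
      "continuous_on UNIV (hs ! (i - 1))"
      using character_continuous[OF cia] by blast+
  next
    fix a
    have "\<phi> a = (\<Prod>i<N. (hs ! i) a)"
      by (simp add: hs(3) prod.list_conv_set_nth hs(1) atLeast0LessThan)
    also have "\<dots> = (\<Prod>i=1..N. (hs ! (i - 1)) a)"
      by (rule prod.reindex_bij_witness[of _ "\<lambda>i. i - 1" Suc]) auto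
    finally show "\<phi> a = (\<Prod>i=1..N. (hs ! (i - 1)) a)" .
  qed
qed

text \<open>Evaluating the product at the scalars \<open>\<i> + of_real r\<close> shows that the
  linear polynomials with roots \<open>- \<psi> i (scale \<i> 1)\<close> multiply to
  \<open>[:\<i>, 1:] ^ N\<close>. Its only root is \<open>- \<i>\<close>, so every
  \<open>\<psi> k\<close> sends \<open>scale \<i> 1\<close> to \<open>\<i>\<close>.\<close>

lemma real_characters_complex_linear:
  fixes scale :: "complex \<Rightarrow> 'a::{comm_ring, comm_monoid_mult} \<Rightarrow> 'a"
  assumes vs: "vector_space scale" and scale_mult: "\<And>c a b. scale c (a * b) = scale c a * b"
    and hom: "\<And>i. i \<in> {1..N::nat} \<Longrightarrow>
      algebra_homomorphism (\<lambda>r. scale (of_real r)) (scaleR :: real \<Rightarrow> complex \<Rightarrow> complex) (\<psi> i)"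
    and prod: "\<And>c. (\<Prod>i=1..N. \<psi> i (scale c 1)) = c ^ N"
    and "k \<in> {1..N}"
  shows "algebra_homomorphism scale ((*) :: complex \<Rightarrow> complex \<Rightarrow> complex) (\<psi> k)"
proof -
  interpret vector_space scale by (rule vs)
  interpret restricted: commutative_real_algebra "\<lambda>r. scale (of_real r)"
    by unfold_locales (simp_all add: scale_right_distrib scale_left_distrib scale_mult)
  have h: "\<psi> i (a + b) = \<psi> i a + \<psi> i b" "\<psi> i (scale (of_real c) a) = c *\<^sub>R \<psi> i a"
    "\<psi> i (a * b) = \<psi> i a * \<psi> i b" if "i \<in> {1..N}" for i a b c
    using hom[OF that] by (simp_all add: restricted.algebra_homomorphism_complex_iff)
  have one: "\<psi> i 1 = 1" if "i \<in> {1..N}" for i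
  proof -
    have "\<psi> i 1 \<noteq> 0"
    proof
      assume "\<psi> i 1 = 0"
      then have "(\<Prod>i=1..N. \<psi> i (scale 1 1)) = 0"
        using that by (intro prod_zero) auto
      then show False unfolding prod by simp
    qed
    then show ?thesis using h(3)[OF that, of 1 1] by simp
  qed
  have "(\<Prod>i=1..N. [:\<psi> i (scale \<i> 1), 1:]) = [:\<i>, 1:] ^ N"
  proof (rule complex_poly_eqI[OF infinite_UNIV_char_0])
    fix r :: real
    have "\<psi> i (scale (\<i> + of_real r) 1) = \<psi> i (scale \<i> 1) + of_real r" if "i \<in> {1..N}" for i
      by (simp only: scale_left_distrib h[OF that] one[OF that]) (simp add: scaleR_conv_of_real)
    then show "poly (\<Prod>i=1..N. [:\<psi> i (scale \<i> 1), 1:]) (of_real r) = poly ([:\<i>, 1:] ^ N) (of_real r)"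
      using prod[of "\<i> + of_real r"] by (simp add: poly_prod)
  qed
  then have "poly (\<Prod>i=1..N. [:\<psi> i (scale \<i> 1), 1:]) (- \<psi> k (scale \<i> 1)) =
      poly ([:\<i>, 1:] ^ N) (- \<psi> k (scale \<i> 1))"
    by simp
  moreover have "poly (\<Prod>i=1..N. [:\<psi> i (scale \<i> 1), 1:]) (- \<psi> k (scale \<i> 1)) = 0"
    using assms(5) by (auto simp: poly_prod prod_zero_iff)
  ultimately have i: "\<psi> k (scale \<i> 1) = \<i>"
    by simp
  have "\<psi> k (scale c a) = c * \<psi> k a" for c a
  proof -
    have "scale \<i> 1 * a = scale \<i> a" by (simp flip: scale_mult)
    then have "scale (of_real (Re c) + \<i> * of_real (Im c)) a =
        scale (of_real (Re c)) a + scale (of_real (Im c)) (scale \<i> 1 * a)"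
      by (simp add: scale_left_distrib mult.commute)
    then have "scale c a = scale (of_real (Re c)) a + scale (of_real (Im c)) (scale \<i> 1 * a)"
      by (simp flip: complex_eq)
    then show ?thesis
      by (simp add: h[OF assms(5)] i scaleR_conv_of_real complex_eq_iff)
  qed
  moreover have "vector_space ((*) :: complex \<Rightarrow> complex \<Rightarrow> complex)"
    by unfold_locales (simp_all add: algebra_simps)
  ultimately show ?thesis
    using vs h[OF assms(5)] by (simp add: algebra_homomorphism_iff)
qed

theorem theorem1p8:
  fixes \<phi> :: "'a::{comm_ring, comm_monoid_mult, topological_ab_group_add,
      topological_semigroup_mult} \<Rightarrow> complex"
    and N :: nat
  assumes continuous: "continuous_on UNIV \<phi>"
    and multiplicative: "\<And>a b. \<phi> (a * b) = \<phi> a * \<phi> b"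
  shows "(\<forall>scale :: real \<Rightarrow> 'a \<Rightarrow> 'a.
      continuous_inverse_algebra scale \<longrightarrow>
      polynomial_map_of_degree scale (scaleR :: real \<Rightarrow> complex \<Rightarrow> complex) N \<phi> \<longrightarrow>
      (\<exists>\<psi> :: nat \<Rightarrow> 'a \<Rightarrow> complex.
        (\<forall>i\<in>{1..N}. continuous_on UNIV (\<psi> i) \<and>
          algebra_homomorphism scale (scaleR :: real \<Rightarrow> complex \<Rightarrow> complex) (\<psi> i)) \<and>
        (\<forall>a. \<phi> a = (\<Prod>i=1..N. \<psi> i a)))) \<and>
    (\<forall>scale :: complex \<Rightarrow> 'a \<Rightarrow> 'a.
      continuous_inverse_algebra scale \<longrightarrow>
      polynomial_map_of_degree scale ((*) :: complex \<Rightarrow> complex \<Rightarrow> complex) N \<phi> \<longrightarrow>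
      (\<exists>\<psi> :: nat \<Rightarrow> 'a \<Rightarrow> complex.
        (\<forall>i\<in>{1..N}. continuous_on UNIV (\<psi> i) \<and>
          algebra_homomorphism scale ((*) :: complex \<Rightarrow> complex \<Rightarrow> complex) (\<psi> i)) \<and>
        (\<forall>a. \<phi> a = (\<Prod>i=1..N. \<psi> i a))))"
proof (intro conjI allI impI)
  fix scale :: "real \<Rightarrow> 'a \<Rightarrow> 'a"
  assume cia: "continuous_inverse_algebra scale"
    and poly: "polynomial_map_of_degree scale (scaleR :: real \<Rightarrow> complex \<Rightarrow> complex) N \<phi>"
  interpret continuous_inverse_algebra scale by fact
  have "(scaleR :: real \<Rightarrow> complex \<Rightarrow> complex) = (\<lambda>c z. of_real c * z)"
    by (simp add: fun_eq_iff scaleR_conv_of_real)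
  note form = multiplicative_polynomial_map[OF poly[unfolded this] _ vector_space_axioms
      scale_mult_left multiplicative]
  show "\<exists>\<psi> :: nat \<Rightarrow> 'a \<Rightarrow> complex.
      (\<forall>i\<in>{1..N}. continuous_on UNIV (\<psi> i) \<and>
        algebra_homomorphism scale (scaleR :: real \<Rightarrow> complex \<Rightarrow> complex) (\<psi> i)) \<and>
      (\<forall>a. \<phi> a = (\<Prod>i=1..N. \<psi> i a))"
    by (rule multiplicative_form_continuous_characters[OF cia multiplicative])
      (use form in simp_all)
next
  fix scale :: "complex \<Rightarrow> 'a \<Rightarrow> 'a"
  assume cia: "continuous_inverse_algebra scale"
    and poly: "polynomial_map_of_degree scale ((*) :: complex \<Rightarrow> complex \<Rightarrow> complex) N \<phi>"
  interpret continuous_inverse_algebra scale by fact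
  note form = multiplicative_polynomial_map[OF poly _ vector_space_axioms scale_mult_left multiplicative]
  \<comment> \<open>Restricting scalars yields characters that are at first only real
    linear.\<close>
  have "\<exists>\<psi> :: nat \<Rightarrow> 'a \<Rightarrow> complex.
      (\<forall>i\<in>{1..N}. continuous_on UNIV (\<psi> i) \<and>
        algebra_homomorphism (\<lambda>r. scale (of_real r)) (scaleR :: real \<Rightarrow> complex \<Rightarrow> complex) (\<psi> i)) \<and>
      (\<forall>a. \<phi> a = (\<Prod>i=1..N. \<psi> i a))"
    by (rule multiplicative_form_continuous_characters
        [OF continuous_inverse_algebra_restrict_scalars[OF cia] multiplicative])
      (use form in simp_all)
  then obtain \<psi> :: "nat \<Rightarrow> 'a \<Rightarrow> complex" where \<psi>: "\<And>i. i \<in> {1..N} \<Longrightarrow> continuous_on UNIV (\<psi> i)"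
    "\<And>i. i \<in> {1..N} \<Longrightarrow>
      algebra_homomorphism (\<lambda>r. scale (of_real r)) (scaleR :: real \<Rightarrow> complex \<Rightarrow> complex) (\<psi> i)"
    "\<And>a. \<phi> a = (\<Prod>i=1..N. \<psi> i a)"
    by blast
  have "(\<Prod>i=1..N. \<psi> i (scale c 1)) = c ^ N" for c
    using form(1) form(2)[of c 1] \<psi>(3)[of "scale c 1"] by simp
  from real_characters_complex_linear[OF vector_space_axioms scale_mult_left \<psi>(2) this]
  show "\<exists>\<psi> :: nat \<Rightarrow> 'a \<Rightarrow> complex.
      (\<forall>i\<in>{1..N}. continuous_on UNIV (\<psi> i) \<and>
        algebra_homomorphism scale ((*) :: complex \<Rightarrow> complex \<Rightarrow> complex) (\<psi> i)) \<and>
      (\<forall>a. \<phi> a = (\<Prod>i=1..N. \<psi> i a))"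
    using \<psi>(1,3) by blast
qed

end
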